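(* For all integers $n\geq 0$ and $k\geq 0$, $$b_{17}\Big(5^{4k}n+\tfrac{2}{3}\big(5^{4k}-1\big)\Big)\equiv 2^k\, b_{17}(n)\pmod{17},$$ and for every $r\in\{0,1,2,4\}$ and all $n,k\geq 0$, $$b_{17}\Big(5^{4k+4}n+\tfrac{1}{3}\big(5^{4k+3}(3r+1)-2\big)\Big)\equiv 0\pmod{17}.$$
   Context: For an integer $l\geq 2$, a partition of a positive integer $n$ is $l$-regular if none of its parts is divisible by $l$. $b_l(n)$ denotes the number of $l$-regular partitions of $n$, with $b_l(0)=1$; equivalently $\sum_{n\ge0} b_l(n)q^n=\prod_{i\ge1}(1-q^{li})/(1-q^i)$. *)

theory Defs
  imports Main "HOL-Library.Multiset" "HOL-Number_Theory.Cong"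
begin

definition l_regular_partitions :: "nat \<Rightarrow> nat \<Rightarrow> nat multiset set" where
  "l_regular_partitions l n =
     {M. sum_mset M = n \<and> (\<forall>x\<in>#M. 0 < x \<and> \<not> l dvd x)}"

definition b :: "nat \<Rightarrow> nat \<Rightarrow> nat" where
  "b l n = card (l_regular_partitions l n)"

end

theory Submission
  imports Defs Complex_Main "HOL-Library.Nat_Bijection"
    "HOL-Computational_Algebra.Polynomial" "HOL-Computational_Algebra.Formal_Laurent_Series"
begin

text \<open>
  Modulo \<open>17\<close> the generating function of \<open>b\<^sub>1\<^sub>7\<close> is \<open>f = E(q)\<^sup>1\<^sup>6\<close> with
  \<open>E(q) = \<Prod>(1 - q\<^sup>i)\<close>, that is, \<open>\<eta>(3\<tau>)\<^sup>1\<^sup>6\<close> up to a power of \<open>q\<close>. The Hecke operator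
  \<open>T\<^sub>5 = U\<^sub>5 + 5\<^sup>7 V\<^sub>5\<close> of weight \<open>8\<close> exchanges the lines spanned by \<open>\<eta>\<^sup>1\<^sup>6\<close> and
  \<open>E\<^sub>4\<eta>\<^sup>8\<close>, and \<open>T\<^sub>5\<^sup>2 f = 92160 f\<close>. Since \<open>92160 \<equiv> 2 * 5\<^sup>7\<close> modulo \<open>17\<close>, both families of
  congruences follow by comparing coefficients.

  The eigenvalue relation is proved without modular forms. By Euler's pentagonal number theorem
  the \<open>5\<close>-dissection of \<open>E\<close> is \<open>E(q) = A + B + C\<close>, with exponents \<open>\<equiv> 0, 1, 2\<close> modulo
  \<open>5\<close>, and \<open>B = - q E(q\<^sup>2\<^sup>5)\<close>; Jacobi's identity
  for \<open>E\<^sup>3\<close> gives \<open>A C = - B\<^sup>2\<close>; and the product of \<open>E(\<zeta>q)\<close> over the fifth roots of unity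
  \<open>\<zeta>\<close> gives \<open>A\<^sup>5 + 11 B\<^sup>5 + C\<^sup>5 = E(q\<^sup>5)\<^sup>6 / E(q\<^sup>2\<^sup>5)\<close>. Hence \<open>E(q)\<close> satisfies a quintic
  equation whose coefficients are monomials in \<open>q E(q\<^sup>2\<^sup>5)\<close> and \<open>E(q\<^sup>5)\<^sup>6 / E(q\<^sup>2\<^sup>5)\<close>, and
  this gives a five-term recurrence for the sections of the powers of \<open>E\<close>.
\<close>

unbundle fps_syntax

subsection \<open>The Euler product and the pentagonal number theorem\<close>

text \<open>Congruence modulo q^K. Infinite products are replaced by finite ones under this
  relation, and \<open>K\<close> is left arbitrary.\<close>

definition fps_agree :: "nat \<Rightarrow> 'a::comm_ring_1 fps \<Rightarrow> 'a fps \<Rightarrow> bool" where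
  "fps_agree K f g \<longleftrightarrow> (\<forall>n<K. f $ n = g $ n)"

lemma fps_agree_refl [simp]: "fps_agree K f f"
  by (simp add: fps_agree_def)

lemma fps_agree_sym: "fps_agree K f g \<Longrightarrow> fps_agree K g f"
  by (simp add: fps_agree_def)

lemma fps_agree_trans [trans]: "fps_agree K f g \<Longrightarrow> fps_agree K g h \<Longrightarrow> fps_agree K f h"
  by (simp add: fps_agree_def)

lemma fps_agree_mult:
  "fps_agree K f f' \<Longrightarrow> fps_agree K g g' \<Longrightarrow> fps_agree K (f * g) (f' * g')"
  by (auto simp: fps_agree_def fps_mult_nth intro!: sum.cong)

lemma fps_agree_power: "fps_agree K f g \<Longrightarrow> fps_agree K (f ^ m) (g ^ m)"
  by (induction m) (auto intro: fps_agree_mult)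

lemma fps_agree_prod:
  "(\<And>i. i \<in> S \<Longrightarrow> fps_agree K (f i) (g i)) \<Longrightarrow> fps_agree K (prod f S) (prod g S)"
  by (induction S rule: infinite_finite_induct) (auto intro: fps_agree_mult)

lemma fps_agree_sum:
  "(\<And>i. i \<in> S \<Longrightarrow> fps_agree K (f i) (g i)) \<Longrightarrow> fps_agree K (sum f S) (sum g S)"
  by (auto simp: fps_agree_def fps_sum_nth intro!: sum.cong)

lemma fps_agree_X_power:
  "K \<le> m \<Longrightarrow> fps_agree K (fps_X ^ m * f) 0"
  by (auto simp: fps_agree_def fps_X_power_mult_nth)

lemma fps_agree_eqI: "(\<And>K. fps_agree K f g) \<Longrightarrow> f = g"
  by (auto simp: fps_agree_def fps_eq_iff)

section \<open>Truncations and limit of the Euler product\<close>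

definition qpoch :: "nat \<Rightarrow> 'a::comm_ring_1 fps" where
  "qpoch n = (\<Prod>i=1..n. 1 - fps_X ^ i)"

text \<open>The infinite product: a factor 1 - q^i with i > n does not touch the coefficient of q^n,
  so \<open>qpoch n\<close> already has the final one.\<close>

definition euler_fps :: "'a::comm_ring_1 fps" where
  "euler_fps = Abs_fps (\<lambda>n. qpoch n $ n)"

lemma qpoch_0 [simp]: "qpoch 0 = 1"
  by (simp add: qpoch_def)

lemma qpoch_Suc: "qpoch (Suc n) = qpoch n * (1 - fps_X ^ Suc n)"
  by (simp add: qpoch_def)

lemma qpoch_nth_0 [simp]: "qpoch n $ 0 = 1"
  by (induction n) (simp_all add: qpoch_Suc)

lemma euler_fps_nth_0 [simp]: "euler_fps $ 0 = 1"
  by (simp add: euler_fps_def)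

lemma fps_agree_qpoch:
  assumes "K \<le> Suc n"
  shows "fps_agree K (qpoch n) euler_fps"
proof -
  have "qpoch n $ m = qpoch m $ m" if "m \<le> n" for m
    using that
  proof (induction n rule: dec_induct)
    case (step n)
    then show ?case
      by (simp add: qpoch_Suc algebra_simps fps_X_power_mult_right_nth del: power_Suc)
  qed simp
  with assms show ?thesis
    unfolding fps_agree_def euler_fps_def fps_nth_Abs_fps by (meson less_Suc_eq_le less_le_trans)
qed

section \<open>Generalized pentagonal numbers and Euler's theorem\<close>

definition pent :: "int \<Rightarrow> nat" where
  "pent s = nat (s * (3 * s - 1) div 2)"

lemma even_pent: "even (s * (3 * s - 1 :: int))"
  by (cases "even s") auto

text \<open>An integer equation replaces \<open>nat\<close> and \<open>div\<close>; neither
  truncates, as s(3s - 1) is nonnegative and even.\<close>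

lemma pent_eq_iff: "pent s = n \<longleftrightarrow> s * (3 * s - 1) = 2 * int n"
proof -
  define z where "z = s * (3 * s - 1)"
  have "0 \<le> z"
    unfolding z_def by (cases "s \<le> 0") (auto intro: mult_nonpos_nonpos)
  moreover have "even z"
    unfolding z_def by (rule even_pent)
  ultimately obtain k where "z = 2 * k" "0 \<le> k" by auto
  then show ?thesis
    unfolding pent_def z_def[symmetric] by auto
qed

lemma two_triangle: "2 * triangle n = n * Suc n"
  by (induction n) auto

lemma pent_of_nat: "pent (int (Suc n)) = n * Suc n + n + triangle n + 1"
  using arg_cong[OF two_triangle[of n], of int]
  by (simp only: pent_eq_iff) (simp add: algebra_simps)

lemma pent_neg_of_nat: "pent (- int n) = n * n + triangle n"
  using arg_cong[OF two_triangle[of n], of int]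
  by (simp only: pent_eq_iff) (simp add: algebra_simps)

text \<open>Shanks's finite form of Euler's pentagonal number theorem: on the left, every
  term except \<open>s = 0\<close> is divisible by \<open>fps_X ^ Suc n\<close>.\<close>

lemma shanks_identity:
  "(\<Sum>s\<le>n. (- 1) ^ s * (\<Prod>i=Suc s..n. 1 - fps_X ^ i) * fps_X ^ (s * n + triangle s)) =
   (\<Sum>s=-int n..int n. (if even s then 1 else - 1) * fps_X ^ pent s :: 'a::comm_ring_1 fps)"
proof (induction n)
  case 0
  show ?case by (simp add: pent_def)
next
  case (Suc n)
  define P :: "nat \<Rightarrow> nat \<Rightarrow> 'a fps" where "P n s = (\<Prod>i=Suc s..n. 1 - fps_X ^ i)" for n s
  let ?X = "fps_X :: 'a fps"
  define T where "T n s = (- 1) ^ s * P n s * ?X ^ (s * n + triangle s)" for n s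
  define R where "R s = (- 1) ^ s * P n s * ?X ^ (s * n + s + n + 1 + triangle s)" for s
  \<comment> \<open>The last factor of \<open>P (Suc n) s\<close> is split off here, the first
    factor of \<open>P n s\<close> in \<open>T_diff\<close>. Both produce the same \<open>R\<close>,
    so the change from n to n + 1 telescopes.\<close>
  have T_Suc: "T (Suc n) s = T n s * ?X ^ s - R s" if "s \<le> n" for s
  proof -
    have "P (Suc n) s = P n s * (1 - ?X ^ Suc n)"
      using that by (simp add: P_def)
    then show ?thesis
      unfolding T_def R_def by (simp only:) (simp add: algebra_simps power_add)
  qed
  have T_diff: "T n (Suc s) * ?X ^ Suc s - T n (Suc s) = R s" if "s < n" for s
  proof -
    have "P n s = (1 - ?X ^ Suc s) * P n (Suc s)"
      using that by (simp add: P_def prod.atLeast_Suc_atMost)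
    then show ?thesis
      unfolding T_def R_def by (simp only:) (simp add: algebra_simps power_add)
  qed
  have "(\<Sum>s\<le>n. T n s * ?X ^ s - T n s) = (\<Sum>s<n. T n (Suc s) * ?X ^ Suc s - T n (Suc s))"
    by (cases n) (simp_all del: power_Suc sum.lessThan_Suc sum.atMost_Suc
        add: sum.atMost_Suc_shift lessThan_Suc_atMost)
  also have "\<dots> = (\<Sum>s<n. R s)"
    by (intro sum.cong refl T_diff) auto
  finally have "(\<Sum>s\<le>n. T (Suc n) s) - (\<Sum>s\<le>n. T n s) = (\<Sum>s<n. R s) - (\<Sum>s\<le>n. R s)"
    by (simp add: T_Suc sum_subtractf algebra_simps)
  also have "\<dots> = - R n"
    by (simp flip: lessThan_Suc_atMost)
  \<comment> \<open>What survives the telescoping, \<open>R n\<close> and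
    \<open>T (Suc n) (Suc n)\<close>, carries the two new pentagonal exponents, for s = n + 1 and s
    = -(n + 1).\<close>
  also have "R n = (- 1) ^ n * ?X ^ pent (int (Suc n))"
    by (simp add: R_def P_def pent_of_nat del: of_nat_Suc) (simp add: algebra_simps)
  finally have "(\<Sum>s\<le>Suc n. T (Suc n) s) =
      (\<Sum>s\<le>n. T n s) + (- 1) ^ Suc n * ?X ^ pent (int (Suc n)) + T (Suc n) (Suc n)"
    by (simp add: algebra_simps)
  also have "T (Suc n) (Suc n) = (- 1) ^ Suc n * ?X ^ pent (- int (Suc n))"
    unfolding pent_neg_of_nat by (simp add: T_def P_def)
  also have "(\<Sum>s\<le>n. T n s) =
      (\<Sum>s=-int n..int n. (if even s then 1 else - 1) * ?X ^ pent s)"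
    using Suc by (simp add: T_def P_def)
  also have "\<dots> + (- 1) ^ Suc n * ?X ^ pent (int (Suc n))
      + (- 1) ^ Suc n * ?X ^ pent (- int (Suc n)) =
      (\<Sum>s=-int (Suc n)..int (Suc n). (if even s then 1 else - 1) * ?X ^ pent s)"
  proof -
    have "{- int (Suc n)..int (Suc n)} =
        insert (int (Suc n)) (insert (- int (Suc n)) {- int n..int n})" by auto
    moreover have "(if even (int (Suc n)) then 1 else - 1) = ((- 1) ^ Suc n :: 'a fps)"
      "(if even (- int (Suc n)) then 1 else - 1) = ((- 1) ^ Suc n :: 'a fps)"
      by (auto simp: minus_one_power_iff)
    ultimately show ?thesis
      by (simp del: of_nat_Suc power_Suc)
  qed
  finally show ?case
    by (simp add: T_def P_def)
qed

text \<open>In Shanks's identity the terms with s > 0 on the left have exponent at least n + 1, so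
  coefficient n comes from \<open>qpoch n\<close> alone; on the right, |s| <= n covers every s with
  \<open>pent s = n\<close>.\<close>

lemma euler_fps_nth:
  "euler_fps $ n = (\<Sum>s | pent s = n. if even s then 1 else - 1 :: 'a::comm_ring_1)"
proof -
  let ?e = "\<lambda>s. if even s then 1 else - 1 :: 'a"
  have bounded: "pent s = n \<Longrightarrow> s \<in> {-int n..int n}" for s
  proof -
    assume "pent s = n"
    then have eq: "s * (3 * s - 1) = 2 * int n"
      by (metis pent_eq_iff)
    have "\<bar>s\<bar> \<le> int n"
    proof (cases "s \<le> 0")
      case True
      then have "(-s) * 1 \<le> (-s) * (-s)"
        by (cases "s = 0") (simp, rule mult_left_mono, auto)
      with eq True show ?thesis by (simp add: algebra_simps)
    next
      case False
      then have "s * 2 \<le> s * (3 * s - 1)"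
        by (intro mult_left_mono) auto
      with eq False show ?thesis by simp
    qed
    then show ?thesis by auto
  qed
  have "fps_agree (Suc n) (\<Sum>s\<le>n. (- 1) ^ s * (\<Prod>i=Suc s..n. 1 - fps_X ^ i)
      * fps_X ^ (s * n + triangle s)) (\<Sum>s\<le>n. if s = 0 then qpoch n else (0 :: 'a fps))"
  proof (rule fps_agree_sum)
    fix s assume "s \<in> {..n}"
    have "Suc n \<le> s * n + triangle s" if "s \<noteq> 0"
      using that by (cases s) auto
    then show "fps_agree (Suc n) ((- 1) ^ s * (\<Prod>i=Suc s..n. 1 - fps_X ^ i)
      * fps_X ^ (s * n + triangle s)) (if s = 0 then qpoch n else (0 :: 'a fps))"
      using fps_agree_X_power[of "Suc n" "s * n + triangle s"
          "(- 1) ^ s * (\<Prod>i=Suc s..n. 1 - fps_X ^ i)"]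
      by (auto simp: qpoch_def mult.commute)
  qed
  then have "(\<Sum>s=-int n..int n. (if even s then 1 else - 1) * fps_X ^ pent s) $ n = (qpoch n $ n :: 'a)"
    unfolding shanks_identity by (simp add: fps_agree_def)
  moreover have "(\<Sum>s=-int n..int n. (if even s then 1 else - 1) * fps_X ^ pent s) $ n =
      (\<Sum>s=-int n..int n. if pent s = n then ?e s else 0)"
    unfolding fps_sum_nth by (rule sum.cong) auto
  ultimately have "euler_fps $ n = (\<Sum>s=-int n..int n. if pent s = n then ?e s else 0)"
    by (simp add: euler_fps_def)
  also have "\<dots> = (\<Sum>s | pent s = n. ?e s)"
    using bounded by (intro sum.mono_neutral_cong_right) auto
  finally show ?thesis .
qed

text \<open>Modulo 5, s(3s - 1) takes only the values 0, 2, 4, so pentagonal numbers are 0, 1 or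
  2.\<close>

lemma euler_fps_nth_eq_0:
  assumes "n mod 5 = 3 \<or> n mod 5 = 4"
  shows "euler_fps $ n = 0"
proof -
  have "pent s \<noteq> n" for s
  proof
    assume "pent s = n"
    then have eq: "s * (3 * s - 1) mod 5 = 2 * int n mod 5"
      by (simp add: pent_eq_iff)
    have "2 * int n mod 5 = 1 \<or> 2 * int n mod 5 = 3"
      using assms by presburger
    moreover have "s mod 5 = 0 \<or> s mod 5 = 1 \<or> s mod 5 = 2 \<or> s mod 5 = 3 \<or> s mod 5 = 4"
      by presburger
    then have "s * (3 * s - 1) mod 5 \<in> {0, 2, 4}"
      by (elim disjE) (simp_all flip: mod_mult_eq mod_diff_eq[of "3 * s"] mod_mult_eq[of 3 s])
    ultimately show False
      using eq by auto
  qed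
  then show ?thesis
    by (simp add: euler_fps_nth)
qed

text \<open>\<open>pent s\<close> is 1 modulo 5 only for s = 1 - 5t, and then it is 25
  \<open>pent t\<close> + 1; the sign flips because s and t have opposite parity. This is B = - q
  E(q^25).\<close>

lemma euler_fps_nth_1_mod_5:
  "euler_fps $ (5 * n + 1) = - (if 5 dvd n then euler_fps $ (n div 5) else (0 :: 'a::comm_ring_1))"
proof -
  have key: "pent s = 5 * n + 1 \<longleftrightarrow> (\<exists>t. s = 1 - 5 * t \<and> 5 * pent t = n)" for s
  proof
    assume "pent s = 5 * n + 1"
    then have eq: "s * (3 * s - 1) = 2 * int (5 * n + 1)"
      by (simp only: pent_eq_iff)
    have "s * (3 * s - 1) mod 5 = 2"
      unfolding eq by presburger
    moreover have "s mod 5 = 0 \<or> s mod 5 = 1 \<or> s mod 5 = 2 \<or> s mod 5 = 3 \<or> s mod 5 = 4"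
      by presburger
    ultimately have "s mod 5 = 1"
      by (elim disjE) (simp_all flip: mod_mult_eq mod_diff_eq[of "3 * s"] mod_mult_eq[of 3 s])
    then obtain u where "s = 5 * u + 1" by (metis mult_div_mod_eq)
    then obtain t where t: "s = 1 - 5 * t" by (metis add.commute diff_minus_eq_add mult_minus_right)
    have "5 * (t * (3 * t - 1)) = 2 * int n"
      using eq unfolding t by (simp add: algebra_simps)
    moreover have "t * (3 * t - 1) = 2 * int (pent t)"
      by (simp flip: pent_eq_iff)
    ultimately have "5 * pent t = n" by linarith
    with t show "\<exists>t. s = 1 - 5 * t \<and> 5 * pent t = n" by blast
  next
    assume "\<exists>t. s = 1 - 5 * t \<and> 5 * pent t = n"
    then obtain t where t: "s = 1 - 5 * t" "n = 5 * pent t" by blast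
    have "t * (3 * t - 1) = 2 * int (pent t)"
      by (simp flip: pent_eq_iff)
    then show "pent s = 5 * n + 1"
      unfolding pent_eq_iff t by (simp add: algebra_simps)
  qed
  show ?thesis
  proof (cases "5 dvd n")
    case True
    then obtain m where m: "n = 5 * m" ..
    have "{s. pent s = 5 * n + 1} = {s. \<exists>t. s = 1 - 5 * t \<and> 5 * pent t = n}"
      by (simp only: key)
    also have "\<dots> = (\<lambda>t. 1 - 5 * t) ` {t. pent t = m}"
      using m by auto
    finally have "euler_fps $ (5 * n + 1) =
        (\<Sum>t | pent t = m. if even (1 - 5 * t) then 1 else - 1 :: 'a)"
      by (simp add: euler_fps_nth sum.reindex inj_on_def)
    also have "\<dots> = - (\<Sum>t | pent t = m. if even t then 1 else - 1)"
      unfolding sum_negf[symmetric] by (rule sum.cong) auto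
    finally show ?thesis
      by (simp add: m euler_fps_nth)
  next
    case False
    then have "{s. pent s = 5 * n + 1} = {}"
      unfolding key by auto
    then show ?thesis
      using False by (simp add: euler_fps_nth)
  qed
qed

subsection \<open>Jacobi's identity\<close>

text \<open>Gaussian binomial coefficients by a q-Pascal rule, which makes sense over any
  commutative ring; \<open>gbin_qpoch\<close> recovers the usual quotient.\<close>

fun gbin :: "nat \<Rightarrow> nat \<Rightarrow> 'a::comm_ring_1 fps" where
  "gbin m 0 = 1"
| "gbin 0 (Suc k) = 0"
| "gbin (Suc m) (Suc k) = gbin m (Suc k) + fps_X ^ (m - k) * gbin m k"

lemma gbin_eq_0: "m < k \<Longrightarrow> gbin m k = 0"
  by (induction m k rule: gbin.induct) auto

lemma gbin_qpoch: "k \<le> m \<Longrightarrow> gbin m k * qpoch k * qpoch (m - k) = qpoch m"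
proof (induction m k rule: gbin.induct)
  case (3 m k)
  let ?X = "fps_X :: 'a fps"
  show ?case
  proof (cases "k = m")
    case True
    with 3(2) have "gbin m m * qpoch m = (qpoch m :: 'a fps)" by simp
    with True show ?thesis by (simp add: gbin_eq_0 qpoch_Suc flip: mult.assoc)
  next
    case False
    with 3(3) obtain l where m: "m = k + Suc l"
      by (metis add_Suc_right le_neq_implies_less less_imp_Suc_add Suc_le_mono)
    have 1: "gbin m (Suc k) * qpoch (Suc k) * qpoch l = (qpoch m :: 'a fps)"
      using 3(1) m by simp
    have 2: "gbin m k * qpoch k * qpoch (Suc l) = (qpoch m :: 'a fps)"
      using 3(2) m by simp
    have "gbin (Suc m) (Suc k) * qpoch (Suc k) * qpoch (Suc m - Suc k) =
        gbin m (Suc k) * qpoch (Suc k) * qpoch l * (1 - ?X ^ Suc l) +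
        ?X ^ Suc l * (gbin m k * qpoch k * qpoch (Suc l)) * (1 - ?X ^ Suc k)"
      by (simp add: m qpoch_Suc algebra_simps)
    also have "\<dots> = qpoch m * (1 - ?X ^ Suc m)"
      unfolding 1 2 by (simp add: m algebra_simps power_add)
    finally show ?thesis by (simp add: qpoch_Suc)
  qed
qed auto

text \<open>The recursion is not symmetric, but the product formula is, and the \<open>qpoch\<close>
  factors are nonzero and cancel.\<close>

lemma gbin_symmetric:
  fixes m k :: nat
  assumes "k \<le> m"
  shows "gbin m (m - k) = (gbin m k :: 'a::idom fps)"
proof -
  have "gbin m (m - k) * (qpoch (m - k) * qpoch k) = (gbin m k * (qpoch (m - k) * qpoch k) :: 'a fps)"
    using gbin_qpoch[of k m, where 'a = 'a] gbin_qpoch[of "m - k" m, where 'a = 'a] assms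
    by (simp add: mult_ac)
  moreover have "qpoch j \<noteq> (0 :: 'a fps)" for j
    by (metis fps_zero_nth qpoch_nth_0 zero_neq_one)
  ultimately show ?thesis by simp
qed

text \<open>The q-binomial theorem, homogenized by \<open>y\<close>: taking y = q^n avoids negative
  powers of q. The exponent \<open>triangle (k - 1)\<close> is k(k - 1)/2, also for k = 0.\<close>

lemma coeff_qbinomial:
  "coeff (\<Prod>i<m. [:y, - (fps_X ^ i):]) k =
     (- 1) ^ k * fps_X ^ triangle (k - 1) * gbin m k * (y :: 'a::comm_ring_1 fps) ^ (m - k)"
proof (induction m arbitrary: k)
  case 0
  show ?case by (cases k) auto
next
  case (Suc m)
  let ?X = "fps_X :: 'a fps"
  show ?case
  proof (cases k)
    case 0
    then show ?thesis using Suc[of 0] by simp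
  next
    case (Suc j)
    have *: "coeff (\<Prod>i<Suc m. [:y, - (?X ^ i):]) k =
        y * ((- 1) ^ k * ?X ^ triangle j * gbin m (Suc j) * y ^ (m - k)) -
        ?X ^ m * ((- 1) ^ j * ?X ^ triangle (j - 1) * gbin m j * y ^ (m - j))"
      by (simp add: Suc Suc.IH del: power_Suc)
    consider "m < j" | "m = j" | "j < m" by linarith
    then show ?thesis
    proof cases
      case 3
      then have y: "y ^ (m - j) = y * y ^ (m - Suc j)"
        by (metis Suc_diff_Suc power_Suc)
      have "triangle (j - 1) + m = triangle j + (m - j)"
        using 3 by (cases j) auto
      then have X: "?X ^ m * ?X ^ triangle (j - 1) = ?X ^ triangle j * ?X ^ (m - j)"
        by (metis add.commute power_add)
      have "coeff (\<Prod>i<Suc m. [:y, - (?X ^ i):]) k =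
          (- 1) ^ k * ?X ^ triangle j * gbin m (Suc j) * (y * y ^ (m - Suc j)) -
          (- 1) ^ j * gbin m j * y ^ (m - j) * (?X ^ m * ?X ^ triangle (j - 1))"
        unfolding * using Suc by (simp add: mult_ac)
      also have "\<dots> = (- 1) ^ k * ?X ^ triangle j * gbin (Suc m) k * y ^ (m - j)"
        unfolding X y[symmetric] using Suc by (simp add: algebra_simps)
      finally show ?thesis using Suc by simp
    next
      case 2
      have X: "?X ^ m * ?X ^ triangle (j - 1) = ?X ^ triangle j"
        unfolding 2 power_add[symmetric] by (cases j) (simp_all add: algebra_simps)
      have "coeff (\<Prod>i<Suc m. [:y, - (?X ^ i):]) k =
          - ((- 1) ^ j * gbin m j * (?X ^ m * ?X ^ triangle (j - 1)))"
        unfolding * using Suc 2 by (simp add: gbin_eq_0 mult_ac)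
      also have "\<dots> = (- 1) ^ k * ?X ^ triangle j * gbin (Suc m) k * y ^ (m - j)"
        unfolding X using Suc 2 by (simp add: gbin_eq_0)
      finally show ?thesis using Suc by simp
    qed (use * Suc in \<open>simp add: gbin_eq_0\<close>)
  qed
qed

lemma poly_pderiv_1_eq_sum:
  "poly (pderiv p) 1 = (\<Sum>k\<le>n. of_nat k * coeff p k)"
  if "degree p \<le> n" for p :: "'a::idom poly"
proof -
  have "poly (pderiv p) 1 = poly (pderiv (\<Sum>k\<le>n. monom (coeff p k) k)) 1"
    using that by (simp add: poly_as_sum_of_monoms')
  also have "pderiv (\<Sum>k\<le>n. monom (coeff p k) k) = (\<Sum>k\<le>n. pderiv (monom (coeff p k) k))"
    by (induction n) (simp_all add: pderiv_add)
  also have "poly \<dots> 1 = (\<Sum>k\<le>n. of_nat k * coeff p k)"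
    by (simp add: pderiv_monom poly_sum poly_monom)
  finally show ?thesis .
qed

lemma triangle_eq_sum: "triangle n = \<Sum>{..n}"
  by (induction n) auto

text \<open>Finite form of Jacobi's identity: the \<open>q\<close>-binomial theorem for the polynomial
  \<open>\<Prod>i\<le>2n. (q\<^sup>n - z q\<^sup>i)\<close> is differentiated at its simple zero \<open>z = 1\<close>.\<close>

lemma finite_jacobi:
  "qpoch n ^ 2 = (\<Sum>j\<le>n. (- 1) ^ j * of_nat (2 * j + 1) * fps_X ^ triangle j
                    * gbin (2 * n + 1) (n - j) :: 'a::idom fps)"
proof -
  let ?X = "fps_X :: 'a fps"
  let ?S = "{..<2 * n + 1}"
  define H where "H = (\<Prod>i\<in>?S. [:?X ^ n, - (?X ^ i):])"
  define R where "R = (\<Prod>i\<in>?S - {n}. [:?X ^ n, - (?X ^ i):])"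
  define e where "e = n * n + triangle n"
  \<comment> \<open>The factor with i = n is the only one vanishing at 1, so the derivative at 1 is
    - q^n times the product of the others.\<close>
  have "H = [:?X ^ n, - (?X ^ n):] * R"
    unfolding H_def R_def by (subst prod.remove[of _ n]) auto
  then have "poly (pderiv H) 1 = - (?X ^ n * poly R 1)"
    by (simp only: pderiv_mult) (simp add: pderiv_pCons)
  also have "poly R 1 = (\<Prod>i\<in>?S - {n}. ?X ^ n - ?X ^ i)"
    by (simp add: R_def poly_prod)
  also have "?S - {n} = {..<n} \<union> {n + 1..<2 * n + 1}" by auto
  also have "(\<Prod>i\<in>\<dots>. ?X ^ n - ?X ^ i) =
      (\<Prod>i<n. ?X ^ n - ?X ^ i) * (\<Prod>i\<in>{n + 1..<2 * n + 1}. ?X ^ n - ?X ^ i)"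
    by (rule prod.union_disjoint) auto
  also have "(\<Prod>i<n. ?X ^ n - ?X ^ i) = (\<Prod>i<n. (- 1) * ?X ^ i * (1 - ?X ^ (n - i)))"
    by (intro prod.cong refl) (simp add: algebra_simps flip: power_add)
  also have "\<dots> = (- 1) ^ n * ?X ^ \<Sum>{..<n} * (\<Prod>i<n. 1 - ?X ^ (n - i))"
    by (simp only: prod.distrib power_sum prod_constant card_lessThan)
  also have "(\<Prod>i<n. 1 - ?X ^ (n - i)) = qpoch n"
    unfolding qpoch_def
    by (rule prod.reindex_bij_witness[of _ "\<lambda>i. n - i" "\<lambda>i. n - i"]) auto
  also have "(\<Prod>i\<in>{n + 1..<2 * n + 1}. ?X ^ n - ?X ^ i) = (\<Prod>i=1..n. ?X ^ n * (1 - ?X ^ i))"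
    by (rule prod.reindex_bij_witness[of _ "\<lambda>i. i + n" "\<lambda>i. i - n"])
      (auto simp: algebra_simps simp flip: power_add)
  also have "\<dots> = ?X ^ (n * n) * qpoch n"
    by (simp add: prod.distrib qpoch_def power_mult)
  finally have "poly (pderiv H) 1 = - ((- 1) ^ n * ?X ^ (n + \<Sum>{..<n} + n * n) * qpoch n ^ 2)"
    by (simp add: power_add power2_eq_square mult_ac)
  also have "n + \<Sum>{..<n} + n * n = e"
    by (simp add: e_def triangle_eq_sum flip: lessThan_Suc_atMost)
  finally have 1: "poly (pderiv H) 1 = (- 1) ^ Suc n * ?X ^ e * qpoch n ^ 2"
    by simp
  define c where "c k = of_nat k * ((- 1) ^ k * ?X ^ triangle (k - 1) * gbin (2 * n + 1) k
      * ?X ^ (n * (2 * n + 1 - k)))" for k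
  have "degree H \<le> 2 * n + 1"
    unfolding H_def by (rule order.trans[OF degree_prod_sum_le]) (auto intro: order.trans[OF sum_bounded_above[of _ _ 1]])
  from poly_pderiv_1_eq_sum[OF this] have "poly (pderiv H) 1 = (\<Sum>k\<le>2 * n + 1. c k)"
    by (simp only: H_def coeff_qbinomial c_def power_mult)
  also have "{..2 * n + 1} = {..n} \<union> {n + 1..2 * n + 1}" by auto
  also have "sum c \<dots> = sum c {..n} + sum c {n + 1..2 * n + 1}"
    by (rule sum.union_disjoint) auto
  also have "sum c {..n} = (\<Sum>j\<le>n. c (n - j))"
    by (rule sum.reindex_bij_witness[of _ "\<lambda>j. n - j" "\<lambda>j. n - j"]) auto
  also have "sum c {n + 1..2 * n + 1} = (\<Sum>j\<le>n. c (n + 1 + j))"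
    by (rule sum.reindex_bij_witness[of _ "\<lambda>j. n + 1 + j" "\<lambda>k. k - (n + 1)"]) auto
  \<comment> \<open>The terms n - j and n + 1 + j share the Gaussian binomial by symmetry, have the
    same power of q and opposite signs; their weights combine to (n + 1 + j) - (n - j) = 2j +
    1.\<close>
  also have "(\<Sum>j\<le>n. c (n - j)) + (\<Sum>j\<le>n. c (n + 1 + j)) =
      (\<Sum>j\<le>n. (- 1) ^ Suc n * ?X ^ e * ((- 1) ^ j * of_nat (2 * j + 1) * ?X ^ triangle j
                    * gbin (2 * n + 1) (n - j)))"
    unfolding sum.distrib[symmetric]
  proof (rule sum.cong[OF refl], goal_cases)
    case (1 j)
    then obtain k where n: "n = j + k" by (auto simp: le_iff_add)
    let ?G = "gbin (2 * n + 1) k :: 'a fps"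
    have "2 * (triangle (k - 1) + k) = k * Suc k"
      using two_triangle[of k] by (cases k) auto
    then have "triangle (k - 1) + n * (n + 1 + j) = e + triangle j"
      using two_triangle[of j] two_triangle[of n]
      by (simp add: e_def n algebra_simps)
    then have X1: "?X ^ triangle (k - 1) * ?X ^ (n * (n + 1 + j)) = ?X ^ e * ?X ^ triangle j"
      by (metis power_add)
    have "triangle (n + j) + n * k = e + triangle j"
      using two_triangle[of j] two_triangle[of n] two_triangle[of "n + j"]
      by (simp add: e_def n algebra_simps)
    then have X2: "?X ^ triangle (n + j) * ?X ^ (n * k) = ?X ^ e * ?X ^ triangle j"
      by (metis power_add)
    have k: "2 * n + 1 - k = n + 1 + j" "2 * n + 1 - (n + 1 + j) = k" "n - j = k"
      by (auto simp: n)
    have G: "gbin (2 * n + 1) (n + 1 + j) = ?G"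
      using gbin_symmetric[of k "2 * n + 1"] unfolding k by (simp add: n)
    have sgn: "(- 1) ^ k = ((- 1) ^ n * (- 1) ^ j :: 'a fps)"
      by (simp add: n minus_one_power_iff)
    have "c (n - j) = of_nat k * (- 1) ^ k * (?X ^ triangle (k - 1) * ?X ^ (n * (n + 1 + j))) * ?G"
      unfolding c_def k by (simp only: mult_ac)
    moreover have "c (n + 1 + j) = of_nat (n + 1 + j) * (- 1) ^ (n + 1 + j)
        * (?X ^ triangle (n + j) * ?X ^ (n * k)) * ?G"
      unfolding c_def k G by (simp add: mult_ac)
    ultimately show ?case
      unfolding X1 X2 k sgn by (simp add: n algebra_simps power_add)
  qed
  finally have "(- 1) ^ Suc n * ?X ^ e * qpoch n ^ 2 = (- 1) ^ Suc n * ?X ^ e *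
      (\<Sum>j\<le>n. (- 1) ^ j * of_nat (2 * j + 1) * ?X ^ triangle j * gbin (2 * n + 1) (n - j))"
    unfolding 1 by (simp only: sum_distrib_left)
  then show ?thesis
    by simp
qed

lemma fps_agree_mult_cancel:
  fixes f g h :: "'a::field fps"
  assumes "fps_agree K (f * h) (g * h)" "h $ 0 \<noteq> 0"
  shows "fps_agree K f g"
proof -
  have "fps_agree K (f * h * inverse h) (g * h * inverse h)"
    by (intro fps_agree_mult assms fps_agree_refl)
  moreover have "f * h * inverse h = f" "g * h * inverse h = g"
    using assms(2) by (simp_all add: mult.assoc inverse_mult_eq_1')
  ultimately show ?thesis by simp
qed

text \<open>The finite identity with n = 2K is multiplied by one more Euler product. For j < K the
  index 2K - j still exceeds K, so \<open>gbin\<close> times that product is 1 modulo q^K by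
  \<open>gbin_qpoch\<close>; for j >= K the power of q is 0 modulo q^K.\<close>

lemma fps_agree_jacobi:
  "fps_agree K (euler_fps ^ 3)
     (\<Sum>j\<le>2 * K. (- 1) ^ j * of_nat (2 * j + 1) * fps_X ^ triangle j :: 'a::field fps)"
proof -
  let ?E = "euler_fps :: 'a fps"
  let ?n = "2 * K"
  have "fps_agree K (?E ^ 2 * ?E) (qpoch ?n ^ 2 * ?E)"
    by (intro fps_agree_mult fps_agree_power fps_agree_sym[OF fps_agree_qpoch]) auto
  also have "qpoch ?n ^ 2 * ?E = (\<Sum>j\<le>?n. (- 1) ^ j * of_nat (2 * j + 1) *
      (fps_X ^ triangle j * (gbin (2 * ?n + 1) (?n - j) * ?E)))"
    unfolding finite_jacobi sum_distrib_right by (simp only: mult_ac)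
  also have "fps_agree K \<dots> (\<Sum>j\<le>?n. (- 1) ^ j * of_nat (2 * j + 1) * fps_X ^ triangle j)"
  proof (intro fps_agree_sum fps_agree_mult fps_agree_refl)
    fix j
    show "fps_agree K (fps_X ^ triangle j * (gbin (2 * ?n + 1) (?n - j) * ?E)) (fps_X ^ triangle j)"
    proof (cases "K \<le> triangle j")
      case True
      then show ?thesis
        using fps_agree_trans[OF fps_agree_X_power fps_agree_sym[OF fps_agree_X_power]]
        by (metis mult.right_neutral)
    next
      case False
      moreover have "j \<le> triangle j" by (cases j) auto
      ultimately have j: "j < K" by linarith
      have q: "fps_agree K ?E (qpoch i)" if "K \<le> i" for i
        using that by (intro fps_agree_sym[OF fps_agree_qpoch]) auto
      have "fps_agree K (gbin (2 * ?n + 1) (?n - j) * ?E * ?E)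
          (gbin (2 * ?n + 1) (?n - j) * qpoch (?n - j) * qpoch (2 * ?n + 1 - (?n - j)))"
        using j by (intro fps_agree_mult fps_agree_refl q) auto
      also have "\<dots> = qpoch (2 * ?n + 1)"
        using j by (intro gbin_qpoch) auto
      also have "fps_agree K \<dots> (1 * ?E)"
        using q[of "2 * ?n + 1"] by (auto intro: fps_agree_sym)
      finally have "fps_agree K (gbin (2 * ?n + 1) (?n - j) * ?E) 1"
        by (rule fps_agree_mult_cancel) simp
      from fps_agree_mult[OF fps_agree_refl this] show ?thesis
        by (metis mult.right_neutral)
    qed
  qed
  finally show ?thesis
    by (simp add: power3_eq_cube power2_eq_square)
qed

text \<open>Triangular numbers are 0, 1 or 3 modulo 5.\<close>

lemma euler_fps_cube_nth_eq_0:
  assumes "n mod 5 = 2 \<or> n mod 5 = 4"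
  shows "(euler_fps ^ 3 :: 'a::field fps) $ n = 0"
proof -
  have "triangle j \<noteq> n" for j
  proof
    assume "triangle j = n"
    then have "j * Suc j mod 5 = 2 * n mod 5"
      using two_triangle[of j] by simp
    moreover have "2 * n mod 5 = 3 \<or> 2 * n mod 5 = 4"
      using assms by presburger
    ultimately have *: "j * Suc j mod 5 = 3 \<or> j * Suc j mod 5 = 4"
      by simp
    have "j mod 5 = 0 \<or> j mod 5 = 1 \<or> j mod 5 = 2 \<or> j mod 5 = 3 \<or> j mod 5 = 4"
      by presburger
    moreover have "j * Suc j mod 5 = (j mod 5) * Suc (j mod 5) mod 5"
      by (metis mod_Suc_eq mod_mult_eq mod_mod_trivial)
    ultimately have "j * Suc j mod 5 \<in> {0, 1, 2}"
      by (elim disjE) simp_all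
    with * show False by auto
  qed
  then have "(fps_const c * fps_X ^ triangle j :: 'a fps) $ n = 0" for c j
    by (metis fps_mult_left_const_nth fps_X_power_nth mult_zero_right)
  moreover have "(euler_fps ^ 3 :: 'a fps) $ n =
      (\<Sum>j\<le>2 * Suc n. (- 1) ^ j * of_nat (2 * j + 1) * fps_X ^ triangle j) $ n"
    using fps_agree_jacobi[of "Suc n"] unfolding fps_agree_def by blast
  moreover have "((- 1) ^ j * of_nat m :: 'a fps) = fps_const ((- 1) ^ j * of_nat m)" for j m
    by (cases "even j") (simp_all flip: fps_of_nat)
  ultimately show ?thesis
    by (simp only: fps_sum_nth sum.neutral_const)
qed

subsection \<open>Five-dissection of the Euler product\<close>

text \<open>Grading of power series by the exponent modulo 5. Degrees are read modulo 5, so those of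
  products may stay unreduced; \<open>res5\<close> projects to one degree and leaves the exponents
  in place.\<close>

definition homog5 :: "nat \<Rightarrow> 'a::comm_ring_1 fps \<Rightarrow> bool" where
  "homog5 r f \<longleftrightarrow> (\<forall>n. f $ n \<noteq> 0 \<longrightarrow> n mod 5 = r mod 5)"

definition res5 :: "nat \<Rightarrow> 'a::comm_ring_1 fps \<Rightarrow> 'a fps" where
  "res5 r f = Abs_fps (\<lambda>n. if n mod 5 = r mod 5 then f $ n else 0)"

lemma homog5_cong: "homog5 r f \<Longrightarrow> r mod 5 = s mod 5 \<Longrightarrow> homog5 s f"
  by (simp add: homog5_def)

lemma homog5_res5: "homog5 r (res5 r f)"
  by (simp add: homog5_def res5_def)

lemma homog5_mult:
  assumes "homog5 r f" "homog5 s g"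
  shows "homog5 (r + s) (f * g)"
  unfolding homog5_def
proof (intro allI impI)
  fix n assume "(f * g) $ n \<noteq> 0"
  then obtain i where i: "i \<le> n" "f $ i * g $ (n - i) \<noteq> 0"
    by (auto simp: fps_mult_nth elim!: sum.not_neutral_contains_not_neutral)
  then have "f $ i \<noteq> 0" "g $ (n - i) \<noteq> 0" by auto
  with assms have "i mod 5 = r mod 5" "(n - i) mod 5 = s mod 5"
    by (auto simp: homog5_def)
  then have "(i + (n - i)) mod 5 = (r + s) mod 5"
    by (metis mod_add_eq)
  with i show "n mod 5 = (r + s) mod 5" by simp
qed

lemma homog5_numeral: "homog5 0 (numeral k)"
  by (auto simp: homog5_def fps_numeral_nth)

lemma homog5_1: "homog5 0 1"
  by (simp add: homog5_def)

lemma homog5_uminus: "homog5 r f \<Longrightarrow> homog5 r (- f)"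
  by (simp add: homog5_def)

lemma homog5_add: "homog5 r f \<Longrightarrow> homog5 r g \<Longrightarrow> homog5 r (f + g)"
  unfolding homog5_def fps_add_nth by (metis add.right_neutral)

lemma homog5_power: "homog5 r f \<Longrightarrow> homog5 (m * r) (f ^ m)"
  by (induction m) (auto simp: homog5_1 intro: homog5_mult)

lemma homog5_compose_X_power: "5 dvd k \<Longrightarrow> k > 0 \<Longrightarrow> homog5 0 (f oo fps_X ^ k)"
  by (auto simp: homog5_def fps_nth_compose_X_power split: if_splits)

lemma res5_mult:
  assumes "homog5 s g" "(r + s) mod 5 = t mod 5"
  shows "res5 t (f * g) = res5 r f * g"
proof (rule fps_ext)
  fix n
  have "(if n mod 5 = t mod 5 then f $ i * g $ (n - i) else 0) =
      (if i mod 5 = r mod 5 then f $ i else 0) * g $ (n - i)" if "i \<le> n" for i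
  proof (cases "g $ (n - i) = 0")
    case False
    with assms(1) have "(n - i) mod 5 = s mod 5" by (auto simp: homog5_def)
    then have "[i + (n - i) = r + s] (mod 5) \<longleftrightarrow> [i + (n - i) = r + (n - i)] (mod 5)"
      by (metis cong_def mod_add_right_eq)
    then have "n mod 5 = t mod 5 \<longleftrightarrow> i mod 5 = r mod 5"
      unfolding cong_add_rcancel_nat using assms(2) that by (simp add: cong_def)
    then show ?thesis by simp
  qed simp
  then have "(\<Sum>i=0..n. if n mod 5 = t mod 5 then f $ i * g $ (n - i) else 0) =
      (\<Sum>i=0..n. (if i mod 5 = r mod 5 then f $ i else 0) * g $ (n - i))"
    by (intro sum.cong refl) simp
  then show "res5 t (f * g) $ n = (res5 r f * g) $ n"
    by (cases "n mod 5 = t mod 5") (simp_all add: res5_def fps_mult_nth)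
qed

lemma res5_cong: "r mod 5 = s mod 5 \<Longrightarrow> res5 r f = res5 s f"
  by (simp add: res5_def)

lemma res5_add: "res5 r (f + g) = res5 r f + res5 r g"
  by (simp add: res5_def fps_eq_iff)

lemma res5_diff: "res5 r (f - g) = res5 r f - res5 r g"
  by (simp add: res5_def fps_eq_iff)

lemma res5_eq_0: "homog5 s f \<Longrightarrow> r mod 5 \<noteq> s mod 5 \<Longrightarrow> res5 r f = 0"
  by (auto simp: res5_def homog5_def fps_eq_iff)

lemma res5_eq_self: "homog5 r f \<Longrightarrow> res5 r f = f"
  by (auto simp: res5_def homog5_def fps_eq_iff)

section \<open>Fifth roots of unity and norms\<close>

lemma fifth_root_traces:
  fixes v :: "'a::comm_ring_1"
  assumes "1 + v + v ^ 2 + v ^ 3 + v ^ 4 = 0"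
  shows "v ^ 2 + v ^ 3 = - 1 - (v + v ^ 4)"
    and "(v + v ^ 4) * (- 1 - (v + v ^ 4)) = - 1"
    and "v ^ 5 = 1"
proof -
  show v5: "v ^ 5 = 1"
    using arg_cong[OF assms(1), of "\<lambda>x. (v - 1) * x"]
    by (simp add: algebra_simps eval_nat_numeral)
  \<comment> \<open>The Gaussian periods v + v^4 and v^2 + v^3 have sum and product -1. The
    hypothesis is the cyclotomic equation itself, so that \<open>v\<close> may also be a constant
    power series.\<close>
  show *: "v ^ 2 + v ^ 3 = - 1 - (v + v ^ 4)"
    using assms by (simp add: algebra_simps add_eq_0_iff)
  have "(v + v ^ 4) * (v ^ 2 + v ^ 3) = v ^ 3 + v ^ 4 + v ^ 5 * v + v ^ 5 * v ^ 2"
    by (simp add: algebra_simps eval_nat_numeral)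
  also have "\<dots> = - 1"
    unfolding v5 using assms by (simp add: algebra_simps add_eq_0_iff)
  finally show "(v + v ^ 4) * (- 1 - (v + v ^ 4)) = - 1"
    unfolding * .
qed

text \<open>Multiplication by \<open>n\<close> permutes the nonzero residues modulo 5.\<close>

lemma fifth_root_sum_power:
  fixes v :: "'a::comm_ring_1"
  assumes "1 + v + v ^ 2 + v ^ 3 + v ^ 4 = 0" "\<not> 5 dvd n"
  shows "1 + v ^ n + (v ^ n) ^ 2 + (v ^ n) ^ 3 + (v ^ n) ^ 4 = 0"
proof -
  have v5: "v ^ 5 = 1"
    by (rule fifth_root_traces(3)[OF assms(1)])
  have pow: "v ^ m = v ^ (m mod 5)" for m
    by (metis mult_div_mod_eq power_add power_mult power_one v5 mult_1)
  have "n mod 5 = 1 \<or> n mod 5 = 2 \<or> n mod 5 = 3 \<or> n mod 5 = 4"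
    using assms(2) by presburger
  then have "v ^ n = v \<or> v ^ n = v ^ 2 \<or> v ^ n = v ^ 3 \<or> v ^ n = v ^ 4"
    using pow[of n] by auto
  moreover have "v ^ 6 = v" "v ^ 8 = v ^ 3" "v ^ 9 = v ^ 4" "v ^ 12 = v ^ 2" "v ^ 16 = v"
    by (subst pow, simp)+
  ultimately show ?thesis
    using assms(1) by (elim disjE) (simp_all add: add_ac flip: power_mult)
qed

lemma prod_fifth_roots:
  fixes v y :: "'a::comm_ring_1"
  assumes v: "1 + v + v ^ 2 + v ^ 3 + v ^ 4 = 0"
  shows "(1 - y) * (1 - v * y) * (1 - v ^ 2 * y) * (1 - v ^ 3 * y) * (1 - v ^ 4 * y) = 1 - y ^ 5"
proof -
  define a where "a = v + v ^ 4"
  have 1: "(1 - v * y) * (1 - v ^ 4 * y) = 1 - a * y + v ^ 5 * y ^ 2"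
    by (simp add: a_def algebra_simps eval_nat_numeral)
  have 2: "(1 - v ^ 2 * y) * (1 - v ^ 3 * y) = 1 - (v ^ 2 + v ^ 3) * y + v ^ 5 * y ^ 2"
    by (simp add: algebra_simps eval_nat_numeral)
  note v' = fifth_root_traces[OF v, folded a_def]
  have "(1 - y) * (1 - v * y) * (1 - v ^ 2 * y) * (1 - v ^ 3 * y) * (1 - v ^ 4 * y) =
      (1 - y) * ((1 - v * y) * (1 - v ^ 4 * y)) * ((1 - v ^ 2 * y) * (1 - v ^ 3 * y))"
    by (simp only: mult_ac)
  also have "\<dots> = (1 - y) * (1 + y + (2 + a * (- 1 - a)) * y ^ 2 + y ^ 3 + y ^ 4)"
    unfolding 1 2 v'(1) v'(3) by (simp add: algebra_simps eval_nat_numeral)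
  also have "\<dots> = 1 - y ^ 5"
    unfolding v'(2) by (simp add: algebra_simps eval_nat_numeral)
  finally show ?thesis .
qed

text \<open>Factors with index j and 5 - j are multiplied first. With t = A + C and A C = - B^2,
  each pair is a quadratic form in t and B whose coefficients involve only a = v + v^4, and a^2 + a
  = 1 removes a.\<close>

lemma norm_trinomial:
  fixes v A B C :: "'a::comm_ring_1"
  assumes v: "1 + v + v ^ 2 + v ^ 3 + v ^ 4 = 0" and AC: "A * C = - (B ^ 2)"
  shows "(A + B + C) * (A + v * B + v ^ 2 * C) * (A + v ^ 2 * B + v ^ 4 * C) *
    (A + v ^ 3 * B + v ^ 6 * C) * (A + v ^ 4 * B + v ^ 8 * C) = A ^ 5 + 11 * B ^ 5 + C ^ 5"
proof -
  define a where "a = v + v ^ 4"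
  define t where "t = A + C"
  note v' = fifth_root_traces[OF v, folded a_def]
  have aa: "1 - a - a ^ 2 = 0"
    using v'(2) by (simp add: algebra_simps power2_eq_square)
  have t2: "A ^ 2 + C ^ 2 = t ^ 2 - 2 * (A * C)"
    by (simp add: t_def algebra_simps power2_eq_square)
  have t5: "A ^ 5 + C ^ 5 = t ^ 5 - 5 * (A * C) * t ^ 3 + 5 * (A * C) ^ 2 * t"
    by (simp add: t_def algebra_simps eval_nat_numeral)
  have "(A + v * B + v ^ 2 * C) * (A + v ^ 4 * B + v ^ 8 * C) =
      (A ^ 2 + C ^ 2 * (v ^ 5) ^ 2) + v ^ 5 * B ^ 2 + A * B * (v + v ^ 4)
      + A * C * (v ^ 2 + v ^ 5 * v ^ 3) + v ^ 5 * (v + v ^ 4) * B * C"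
    by (simp add: algebra_simps eval_nat_numeral)
  also have "\<dots> = (A ^ 2 + C ^ 2) + B ^ 2 + A * B * a + A * C * (- 1 - a) + a * B * C"
    unfolding v'(3) a_def[symmetric] using v'(1) by simp
  also have "\<dots> = t ^ 2 + a * B * t + (4 + a) * B ^ 2"
    unfolding t2 AC by (simp add: t_def algebra_simps)
  finally have 1: "(A + v * B + v ^ 2 * C) * (A + v ^ 4 * B + v ^ 8 * C) =
    t ^ 2 + a * B * t + (4 + a) * B ^ 2" .
  have "(A + v ^ 2 * B + v ^ 4 * C) * (A + v ^ 3 * B + v ^ 6 * C) =
      (A ^ 2 + C ^ 2 * (v ^ 5) ^ 2) + v ^ 5 * B ^ 2 + A * B * (v ^ 2 + v ^ 3)
      + A * C * (v ^ 5 * v + v ^ 4) + v ^ 5 * (v ^ 2 + v ^ 3) * B * C"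
    by (simp add: algebra_simps eval_nat_numeral)
  also have "\<dots> = (A ^ 2 + C ^ 2) + B ^ 2 + A * B * (- 1 - a) + A * C * a + (- 1 - a) * B * C"
    unfolding v' by (simp add: a_def)
  also have "\<dots> = t ^ 2 - (1 + a) * B * t + (3 - a) * B ^ 2"
    unfolding t2 AC by (simp add: t_def algebra_simps)
  finally have 2: "(A + v ^ 2 * B + v ^ 4 * C) * (A + v ^ 3 * B + v ^ 6 * C) =
    t ^ 2 - (1 + a) * B * t + (3 - a) * B ^ 2" .
  have "(A + B + C) * (A + v * B + v ^ 2 * C) * (A + v ^ 2 * B + v ^ 4 * C) *
      (A + v ^ 3 * B + v ^ 6 * C) * (A + v ^ 4 * B + v ^ 8 * C) =
      (t + B) * ((A + v * B + v ^ 2 * C) * (A + v ^ 4 * B + v ^ 8 * C)) *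
      ((A + v ^ 2 * B + v ^ 4 * C) * (A + v ^ 3 * B + v ^ 6 * C))"
    by (simp only: t_def mult_ac add_ac)
  also have "\<dots> = (t + B) * (t ^ 4 - B * t ^ 3 + 6 * B ^ 2 * t ^ 2 - 6 * B ^ 3 * t + 11 * B ^ 4
      + (1 - a - a ^ 2) * (B ^ 2 * t ^ 2 + 2 * B ^ 3 * t + B ^ 4))"
    unfolding 1 2 by (simp add: algebra_simps eval_nat_numeral)
  also have "\<dots> = t ^ 5 + 5 * B ^ 2 * t ^ 3 + 5 * B ^ 4 * t + 11 * B ^ 5"
    unfolding aa by (simp add: algebra_simps eval_nat_numeral)
  also have "\<dots> = A ^ 5 + 11 * B ^ 5 + C ^ 5"
    using t5 unfolding AC by (simp add: algebra_simps eval_nat_numeral)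
  finally show ?thesis .
qed

lemma ex_primitive_fifth_root: "\<exists>w :: complex. 1 + w + w ^ 2 + w ^ 3 + w ^ 4 = 0"
proof
  let ?w = "cis (2 * pi / 5)"
  have "?w ^ 5 = 1"
    by (simp add: DeMoivre)
  moreover have "(w - 1) * (1 + w + w ^ 2 + w ^ 3 + w ^ 4) = w ^ 5 - 1" for w :: complex
    by (simp add: algebra_simps eval_nat_numeral)
  ultimately have "(?w - 1) * (1 + ?w + ?w ^ 2 + ?w ^ 3 + ?w ^ 4) = 0"
    by simp
  moreover have "sin (2 * pi / 5) > 0"
    by (rule sin_gt_zero) auto
  then have "?w \<noteq> 1"
    by (auto simp: complex_eq_iff)
  ultimately show "1 + ?w + ?w ^ 2 + ?w ^ 3 + ?w ^ 4 = 0"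
    by simp
qed

lemma fps_agree_compose_X_power:
  "k > 0 \<Longrightarrow> fps_agree K f g \<Longrightarrow> fps_agree K (f oo fps_X ^ k) (g oo fps_X ^ k)"
  by (auto simp: fps_agree_def fps_nth_compose_X_power intro: le_less_trans[OF div_le_dividend])

lemma fps_agree_compose_linear:
  "fps_agree K f g \<Longrightarrow> fps_agree K (f oo (fps_const c * fps_X)) (g oo (fps_const c * fps_X))"
  by (simp add: fps_agree_def)

definition fps_norm5 :: "'a::comm_ring_1 \<Rightarrow> 'a fps \<Rightarrow> 'a fps" where
  "fps_norm5 w f = (\<Prod>j<5. f oo (fps_const (w ^ j) * fps_X))"

lemma fps_norm5_mult: "fps_norm5 w (f * g) = fps_norm5 w f * fps_norm5 (w :: 'a::idom) g"
  by (simp add: fps_norm5_def fps_compose_mult_distrib prod.distrib)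

text \<open>For \<open>n\<close> prime to 5, w^n again satisfies the cyclotomic equation and
  \<open>prod_fifth_roots\<close> applies; otherwise all five factors coincide.\<close>

lemma fps_norm5_1_minus_X_power:
  fixes w :: "'a::idom"
  assumes w: "1 + w + w ^ 2 + w ^ 3 + w ^ 4 = 0"
  shows "fps_norm5 w (1 - fps_X ^ n) = (if 5 dvd n then (1 - fps_X ^ n) ^ 5 else 1 - fps_X ^ (5 * n))"
proof -
  let ?v = "fps_const (w ^ n)"
  have "fps_norm5 w (1 - fps_X ^ n) = (\<Prod>j<5. 1 - ?v ^ j * fps_X ^ n)"
    by (simp add: fps_norm5_def fps_compose_sub_distrib power_mult_distrib fps_const_power
        mult.commute flip: fps_compose_power power_mult)
  also have "\<dots> = (1 - fps_X ^ n) * (1 - ?v * fps_X ^ n) * (1 - ?v ^ 2 * fps_X ^ n)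
      * (1 - ?v ^ 3 * fps_X ^ n) * (1 - ?v ^ 4 * fps_X ^ n)"
    by (simp add: eval_nat_numeral)
  also have "\<dots> = (if 5 dvd n then (1 - fps_X ^ n) ^ 5 else 1 - fps_X ^ (5 * n))"
  proof (cases "5 dvd n")
    case True
    then obtain m where "n = 5 * m" ..
    then have "?v = 1"
      using fifth_root_traces(3)[OF w] by (simp add: power_mult)
    with True show ?thesis by (simp add: eval_nat_numeral)
  next
    case False
    have "fps_const (1 + w ^ n + (w ^ n) ^ 2 + (w ^ n) ^ 3 + (w ^ n) ^ 4) = 0"
      unfolding fifth_root_sum_power[OF w False] by simp
    then have "1 + ?v + ?v ^ 2 + ?v ^ 3 + ?v ^ 4 = 0"
      by (simp only: fps_const_power flip: fps_const_add fps_const_1_eq_1)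
    from prod_fifth_roots[OF this] False show ?thesis
      by (simp add: mult.commute flip: power_mult)
  qed
  finally show ?thesis .
qed

text \<open>Indices i prime to 5 contribute 1 - q^(5i). These are the factors of
  \<open>qpoch (5 * M)\<close> at q^5 except for the 1 - q^(25i), which \<open>qpoch M\<close> at
  q^25 restores on the left. Multiples 5i contribute (1 - q^(5i))^5.\<close>

lemma fps_norm5_qpoch:
  fixes w :: "'a::idom"
  assumes w: "1 + w + w ^ 2 + w ^ 3 + w ^ 4 = 0"
  shows "fps_norm5 w (qpoch (5 * M)) * (qpoch M oo fps_X ^ 25) =
    (qpoch (5 * M) oo fps_X ^ 5) * (qpoch M oo fps_X ^ 5) ^ 5"
proof (induction M)
  case 0
  show ?case by (simp add: fps_norm5_def)
next
  case (Suc M)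
  let ?X = "fps_X :: 'a fps"
  define Q where "Q = (1 - ?X ^ (5 * M + 1)) * (1 - ?X ^ (5 * M + 2)) * (1 - ?X ^ (5 * M + 3))
      * (1 - ?X ^ (5 * M + 4))"
  have q: "qpoch (5 * Suc M) = qpoch (5 * M) * (Q * (1 - ?X ^ (5 * M + 5)))"
    by (simp add: Q_def qpoch_Suc mult.assoc eval_nat_numeral)
  have "fps_norm5 w Q = (1 - ?X ^ (5 * (5 * M + 1))) * (1 - ?X ^ (5 * (5 * M + 2)))
      * (1 - ?X ^ (5 * (5 * M + 3))) * (1 - ?X ^ (5 * (5 * M + 4)))"
  proof -
    have "\<not> 5 dvd 5 * M + 1" "\<not> 5 dvd 5 * M + 2" "\<not> 5 dvd 5 * M + 3" "\<not> 5 dvd 5 * M + 4"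
      by presburger+
    then show ?thesis
      by (simp only: Q_def fps_norm5_mult fps_norm5_1_minus_X_power[OF w] if_False)
  qed
  also have "\<dots> = Q oo ?X ^ 5"
  proof -
    have "(1 - ?X ^ m) oo ?X ^ 5 = 1 - ?X ^ (5 * m)" for m
      by (simp add: fps_compose_sub_distrib fps_X_power_compose power_mult)
    moreover have "?X ^ 5 $ 0 = 0" by simp
    ultimately show ?thesis
      by (simp only: Q_def fps_compose_mult_distrib)
  qed
  finally have Q: "fps_norm5 w Q = Q oo ?X ^ 5" .
  have n: "fps_norm5 w (1 - ?X ^ (5 * M + 5)) = (1 - ?X ^ (5 * M + 5)) ^ 5"
    by (simp add: fps_norm5_1_minus_X_power[OF w])
  have c: "(1 - ?X ^ Suc M) oo ?X ^ 25 = 1 - ?X ^ (25 * Suc M)"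
    "(1 - ?X ^ Suc M) oo ?X ^ 5 = 1 - ?X ^ (5 * M + 5)"
    "(1 - ?X ^ (5 * M + 5)) oo ?X ^ 5 = 1 - ?X ^ (25 * Suc M)"
    by (simp_all add: fps_compose_sub_distrib fps_X_power_compose algebra_simps
        flip: power_mult del: power_Suc)
  have z: "?X ^ 5 $ 0 = 0" by simp
  have "fps_norm5 w (qpoch (5 * Suc M)) * (qpoch (Suc M) oo ?X ^ 25) =
      fps_norm5 w (qpoch (5 * M)) * (qpoch M oo ?X ^ 25)
      * (Q oo ?X ^ 5) * (1 - ?X ^ (5 * M + 5)) ^ 5 * (1 - ?X ^ (25 * Suc M))"
    by (simp only: q fps_norm5_mult Q n qpoch_Suc fps_compose_mult_distrib c fps_X_power_nth)
      (simp add: mult_ac fps_compose_mult_distrib c del: power_Suc)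
  also have "\<dots> = (qpoch (5 * Suc M) oo ?X ^ 5) * (qpoch (Suc M) oo ?X ^ 5) ^ 5"
    unfolding Suc q qpoch_Suc
    by (simp only: fps_compose_mult_distrib[OF z] c power_mult_distrib) (simp only: mult_ac)
  finally show ?case .
qed

lemma fps_norm5_euler:
  fixes w :: "'a::idom"
  assumes w: "1 + w + w ^ 2 + w ^ 3 + w ^ 4 = 0"
  shows "fps_norm5 w euler_fps * (euler_fps oo fps_X ^ 25) = (euler_fps oo fps_X ^ 5) ^ 6"
proof (rule fps_agree_eqI)
  fix K
  have a: "fps_agree K euler_fps (qpoch K :: 'a fps)" "fps_agree K euler_fps (qpoch (5 * K) :: 'a fps)"
    by (intro fps_agree_sym[OF fps_agree_qpoch]; simp)+
  have "fps_agree K (fps_norm5 w euler_fps * (euler_fps oo fps_X ^ 25))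
      (fps_norm5 w (qpoch (5 * K)) * (qpoch K oo fps_X ^ 25))"
    unfolding fps_norm5_def
    by (intro fps_agree_mult fps_agree_prod fps_agree_compose_linear fps_agree_compose_X_power a) simp
  also have "\<dots> = (qpoch (5 * K) oo fps_X ^ 5) * (qpoch K oo fps_X ^ 5) ^ 5"
    by (rule fps_norm5_qpoch[OF w])
  also have "fps_agree K \<dots> ((euler_fps oo fps_X ^ 5) * (euler_fps oo fps_X ^ 5) ^ 5)"
    by (intro fps_agree_mult fps_agree_power fps_agree_compose_X_power fps_agree_sym[OF a(1)]
        fps_agree_sym[OF a(2)]) simp_all
  finally show "fps_agree K (fps_norm5 w euler_fps * (euler_fps oo fps_X ^ 25))
      ((euler_fps oo fps_X ^ 5) ^ 6)"
    by (simp add: eval_nat_numeral)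
qed

section \<open>Components modulo 5 of powers of the Euler product\<close>

abbreviation E1 :: "complex fps" where "E1 \<equiv> euler_fps"
abbreviation E5 :: "complex fps" where "E5 \<equiv> euler_fps oo fps_X ^ 5"
abbreviation E25 :: "complex fps" where "E25 \<equiv> euler_fps oo fps_X ^ 25"

lemma res5_1_euler: "res5 1 E1 = - (fps_X * E25)"
proof (rule fps_ext)
  fix n
  show "res5 1 E1 $ n = (- (fps_X * E25)) $ n"
  proof (cases "n mod 5 = 1")
    case True
    then have r: "res5 1 E1 $ n = E1 $ n" by (simp add: res5_def)
    from True obtain m where n: "n = 5 * m + 1" by (metis mult_div_mod_eq)
    show ?thesis
    proof (cases "5 dvd m")
      case True
      then obtain k where k: "m = 5 * k" ..
      show ?thesis
        unfolding r unfolding n using euler_fps_nth_1_mod_5[of m, where 'a = complex]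
        by (simp add: k fps_nth_compose_X_power)
    next
      case False
      then have "\<not> 25 dvd 5 * m" by presburger
      with False show ?thesis
        unfolding r unfolding n using euler_fps_nth_1_mod_5[of m, where 'a = complex]
        by (simp add: fps_nth_compose_X_power)
    qed
  next
    case False
    have "\<not> 25 dvd n - 1" if "n > 0"
      using False that by presburger
    with False show ?thesis
      by (simp add: res5_def fps_nth_compose_X_power fps_X_mult_nth)
  qed
qed

text \<open>Only the shape of the dissection is assumed, because \<open>res5_2_cube\<close> serves
  to prove the relation \<open>AC\<close> assumed in \<open>euler_dissection\<close>.\<close>

locale dissection5 =
  fixes A B C E :: "complex fps"
  assumes E_eq: "E = A + B + C"
    and homog: "homog5 0 A" "homog5 1 B" "homog5 2 C"
begin

lemma res5_mult_E:
  "res5 0 (f * E) = res5 0 f * A + res5 4 f * B + res5 3 f * C"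
  "res5 1 (f * E) = res5 1 f * A + res5 0 f * B + res5 4 f * C"
  "res5 2 (f * E) = res5 2 f * A + res5 1 f * B + res5 0 f * C"
  "res5 3 (f * E) = res5 3 f * A + res5 2 f * B + res5 1 f * C"
  "res5 4 (f * E) = res5 4 f * A + res5 3 f * B + res5 2 f * C"
  by (simp_all add: E_eq distrib_left res5_add res5_mult[OF homog(1), of 0 0]
      res5_mult[OF homog(1), of 1 1] res5_mult[OF homog(1), of 2 2]
      res5_mult[OF homog(1), of 3 3] res5_mult[OF homog(1), of 4 4]
      res5_mult[OF homog(2), of 4 0]
      res5_mult[OF homog(2), of 0 1] res5_mult[OF homog(2), of 1 2]
      res5_mult[OF homog(2), of 2 3] res5_mult[OF homog(2), of 3 4]
      res5_mult[OF homog(3), of 3 0]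
      res5_mult[OF homog(3), of 4 1] res5_mult[OF homog(3), of 0 2]
      res5_mult[OF homog(3), of 1 3] res5_mult[OF homog(3), of 2 4] del: One_nat_def)

lemma res5_one:
  "res5 0 1 = (1 :: complex fps)" "res5 1 1 = (0 :: complex fps)"
  "res5 2 1 = (0 :: complex fps)" "res5 3 1 = (0 :: complex fps)" "res5 4 1 = (0 :: complex fps)"
  by (auto simp: res5_eq_self res5_eq_0 homog5_1 intro!: res5_eq_0[OF homog5_1])

text \<open>The leading factor 1 lets \<open>res5_mult_E\<close> expand a power of \<open>E\<close>
  until only components of 1 remain.\<close>

lemma power_E: "E ^ 1 = 1 * E" "E ^ 2 = 1 * E * E" "E ^ 3 = 1 * E * E * E" "E ^ 4 = 1 * E * E * E * E"
  by (simp_all add: eval_nat_numeral mult.assoc)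

text \<open>Jacobi's identity makes this component vanish for the Euler product, which forces A C =
  - B^2.\<close>

lemma res5_2_cube: "res5 2 (E ^ 3) = 3 * A * (A * C + B ^ 2)"
  unfolding power_E res5_mult_E res5_one by (simp add: algebra_simps power2_eq_square)

end

locale euler_dissection = dissection5 +
  fixes u N :: "complex fps"
  assumes AC: "A * C = - (B ^ 2)"
    and u_def: "u = - B"
    and N_def: "N = A ^ 5 + 11 * B ^ 5 + C ^ 5"
begin

text \<open>A^5 + C^5 is a polynomial in t = A + C and A C = - u^2, so N is one in t and u;
  substituting t = E + u gives an equation for E.\<close>

lemma quintic:
  "E ^ 5 = E ^ 0 * N - E ^ 1 * (25 * u ^ 4)
    - E ^ 2 * (25 * u ^ 3) - E ^ 3 * (15 * u ^ 2) - E ^ 4 * (5 * u)"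
proof -
  define t where "t = A + C"
  have t5: "A ^ 5 + C ^ 5 = t ^ 5 - 5 * (A * C) * t ^ 3 + 5 * (A * C) ^ 2 * t"
    by (simp add: t_def algebra_simps eval_nat_numeral)
  have N: "N = t ^ 5 + 5 * u ^ 2 * t ^ 3 + 5 * u ^ 4 * t - 11 * u ^ 5"
    using t5 unfolding AC N_def u_def by (simp add: algebra_simps eval_nat_numeral)
  have E: "E = t - u"
    by (simp add: E_eq t_def u_def)
  show ?thesis
    unfolding N E by (simp add: algebra_simps eval_nat_numeral)
qed

text \<open>In the quintic the coefficient of E^j has degree 5 - j modulo 5, so the components of
  degree k of E^k satisfy a recurrence among themselves.\<close>

definition P :: "nat \<Rightarrow> complex fps" where "P k = res5 k (E ^ k)"

lemma homog5_N: "homog5 0 N"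
proof -
  have "homog5 0 (A ^ 5)" "homog5 0 (11 * B ^ 5)" "homog5 0 (C ^ 5)"
    using homog5_cong[OF homog5_power[OF homog(1), of 5], of 0]
      homog5_cong[OF homog5_mult[OF homog5_numeral homog5_power[OF homog(2), of 5]], of 0]
      homog5_cong[OF homog5_power[OF homog(3), of 5], of 0] by simp_all
  then show ?thesis
    unfolding N_def by (intro homog5_add)
qed

lemma homog5_u: "homog5 m (numeral k * u ^ m)"
  using homog5_mult[OF homog5_numeral[of k] homog5_power[OF homog5_uminus[OF homog(2)], of m]]
  by (simp add: u_def)

lemma P_rec: "P (k + 5) = P k * N - P (k + 1) * (25 * u ^ 4) - P (k + 2) * (25 * u ^ 3)
    - P (k + 3) * (15 * u ^ 2) - P (k + 4) * (5 * u)"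
proof -
  have "E ^ (k + 5) = E ^ k * N - E ^ (k + 1) * (25 * u ^ 4) - E ^ (k + 2) * (25 * u ^ 3)
    - E ^ (k + 3) * (15 * u ^ 2) - E ^ (k + 4) * (5 * u ^ 1)"
    unfolding power_add quintic by (simp add: algebra_simps)
  then show ?thesis
    unfolding P_def
    by (simp add: res5_diff res5_mult[OF homog5_N, of k] res5_mult[OF homog5_u, of "k + 1"]
      res5_mult[OF homog5_u, of "k + 2"] res5_mult[OF homog5_u, of "k + 3"]
      res5_mult[OF homog5_u[of 1, simplified], of "k + 4"] add.assoc del: One_nat_def)
qed

text \<open>For k <= 4, a product of k factors A, B, C has degree k only if A and C occur equally
  often, so \<open>P k\<close> is a polynomial in A C and B.\<close>

lemma P_initial: "P 0 = 1" "P 1 = - u" "P 2 = - (u ^ 2)" "P 3 = 5 * u ^ 3" "P 4 = - 5 * u ^ 4"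
proof -
  show "P 0 = 1"
    unfolding P_def by (simp add: res5_one)
  show "P 1 = - u"
    unfolding P_def power_E res5_mult_E res5_one by (simp add: u_def)
  have "P 2 = 2 * (A * C) + B ^ 2"
    unfolding P_def power_E res5_mult_E res5_one by (simp add: algebra_simps power2_eq_square)
  then show "P 2 = - (u ^ 2)"
    unfolding AC by (simp add: u_def)
  have "P 3 = 6 * (A * C) * B + B ^ 3"
    unfolding P_def power_E res5_mult_E res5_one by (simp add: algebra_simps eval_nat_numeral)
  then show "P 3 = 5 * u ^ 3"
    unfolding AC by (simp add: u_def eval_nat_numeral algebra_simps)
  have "P 4 = 6 * (A * C) ^ 2 + 12 * (A * C) * B ^ 2 + B ^ 4"
    unfolding P_def power_E res5_mult_E res5_one by (simp add: algebra_simps eval_nat_numeral)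
  then show "P 4 = - 5 * u ^ 4"
    unfolding AC by (simp add: u_def eval_nat_numeral algebra_simps)
qed

text \<open>Index 16 serves the first Hecke step; 6, 12 and 18 serve the second, whose input
  combines E^6, E^12 and E^18 with dilated coefficients.\<close>

lemma P_values:
  "P 6 = - 25 * u ^ 6 - 6 * u * N"
  "P 12 = - 3125 * u ^ 12 + 54 * u ^ 2 * N ^ 2"
  "P 16 = - 78125 * u ^ 16 - 50000 * u ^ 11 * N - 4000 * u ^ 6 * N ^ 2 - 16 * u * N ^ 3"
  "P 18 = - 390625 * u ^ 18 - 510 * u ^ 3 * N ^ 3"
proof -
  have init: "P (Suc 0) = - u" "P (Suc (Suc 0)) = - (u ^ 2)" "P (Suc (Suc (Suc 0))) = 5 * u ^ 3"
      "P 2 = - (u ^ 2)" "P 3 = 5 * u ^ 3" "P 4 = - 5 * u ^ 4"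
    using P_initial by (simp_all add: numeral_2_eq_2 numeral_3_eq_3)
  have "P 5 = 1 * N - (- u) * (25 * u ^ 4) - (- (u ^ 2)) * (25 * u ^ 3)
      - 5 * u ^ 3 * (15 * u ^ 2) - (- 5 * u ^ 4) * (5 * u)"
    using P_rec[of 0] by (simp only: add_0 P_initial)
  also have "\<dots> = N"
    by (simp add: algebra_simps eval_nat_numeral)
  finally have 5: "P 5 = N" .
  have 6: "P 6 = - 25 * u ^ 6 - 6 * u * N"
    using P_rec[of 1] by (simp add: init 5)
  have 7: "P 7 = 125 * u ^ 7 + 14 * u ^ 2 * N"
    unfolding P_rec[of 2, simplified] init 5 6 by algebra
  have 8: "P 8 = - 125 * u ^ 8"
    unfolding P_rec[of 3, simplified] init 5 6 7 by algebra
  have 9: "P 9 = - 625 * u ^ 9 - 90 * u ^ 4 * N"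
    unfolding P_rec[of 4, simplified] init 5 6 7 8 by algebra
  have 10: "P 10 = 2500 * u ^ 10 + 250 * u ^ 5 * N + N ^ 2"
    unfolding P_rec[of 5, simplified] 5 6 7 8 9 by algebra
  have 11: "P 11 = - 3125 * u ^ 11 - 275 * u ^ 6 * N - 11 * u * N ^ 2"
    unfolding P_rec[of 6, simplified] 6 7 8 9 10 by algebra
  have 12: "P 12 = - 3125 * u ^ 12 + 54 * u ^ 2 * N ^ 2"
    unfolding P_rec[of 7, simplified] 7 8 9 10 11 by algebra
  have 13: "P 13 = 15625 * u ^ 13 - 130 * u ^ 3 * N ^ 2"
    unfolding P_rec[of 8, simplified] 8 9 10 11 12 by algebra
  have 14: "P 14 = - 15625 * u ^ 14"
    unfolding P_rec[of 9, simplified] 9 10 11 12 13 by algebra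
  have 15: "P 15 = 9375 * u ^ 10 * N + 1125 * u ^ 5 * N ^ 2 + N ^ 3"
    unfolding P_rec[of 10, simplified] 10 11 12 13 14 by algebra
  have 16: "P 16 = - 78125 * u ^ 16 - 50000 * u ^ 11 * N - 4000 * u ^ 6 * N ^ 2 - 16 * u * N ^ 3"
    unfolding P_rec[of 11, simplified] 11 12 13 14 15 by algebra
  have 17: "P 17 = 390625 * u ^ 17 + 106250 * u ^ 12 * N + 6375 * u ^ 7 * N ^ 2 + 119 * u ^ 2 * N ^ 3"
    unfolding P_rec[of 12, simplified] 12 13 14 15 16 by algebra
  have 18: "P 18 = - 390625 * u ^ 18 - 510 * u ^ 3 * N ^ 3"
    unfolding P_rec[of 13, simplified] 13 14 15 16 17 by algebra
  show "P 6 = - 25 * u ^ 6 - 6 * u * N"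
    "P 12 = - 3125 * u ^ 12 + 54 * u ^ 2 * N ^ 2"
    "P 16 = - 78125 * u ^ 16 - 50000 * u ^ 11 * N - 4000 * u ^ 6 * N ^ 2 - 16 * u * N ^ 3"
    "P 18 = - 390625 * u ^ 18 - 510 * u ^ 3 * N ^ 3"
    by (rule 6 12 16 18)+
qed

text \<open>Up to powers of \<open>q\<close>, this says that the two expressions of the Eisenstein series
  \<open>E\<^sub>4(5\<tau>)\<close> as combinations of eta quotients, of level \<open>5\<close> and of level \<open>25\<close>, agree.\<close>

lemma eisenstein_identity:
  "E ^ 2 * (N ^ 2 + 250 * u ^ 5 * N + 3125 * u ^ 10) =
    E ^ 12 + 10 * u * E ^ 6 * N + 5 * u ^ 2 * N ^ 2"
proof -
  \<comment> \<open>Eliminating N by the quintic leaves an identity between polynomials in E and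
    u.\<close>
  have "N = E ^ 5 + 25 * u ^ 4 * E + 25 * u ^ 3 * E ^ 2 + 15 * u ^ 2 * E ^ 3 + 5 * u * E ^ 4"
    using quintic by (simp add: algebra_simps)
  then show ?thesis by algebra
qed

end

subsection \<open>The Hecke operator at 5\<close>

lemma homog5_compose_linear:
  assumes "homog5 r f" "c ^ 5 = 1"
  shows "f oo (fps_const c * fps_X) = fps_const (c ^ r) * f"
proof (rule fps_ext)
  fix n
  have pow: "c ^ m = c ^ (m mod 5)" for m
    by (metis mult_div_mod_eq power_add power_mult power_one assms(2) mult_1)
  have "c ^ n = c ^ r" if "f $ n \<noteq> 0"
    using assms(1) that pow[of n] pow[of r] by (simp add: homog5_def)
  then show "(f oo (fps_const c * fps_X)) $ n = (fps_const (c ^ r) * f) $ n"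
    by (cases "f $ n = 0") auto
qed

lemma euler_dissection_euler:
  "euler_dissection (res5 0 E1) (res5 1 E1) (res5 2 E1) E1 (fps_X * E25) (E5 ^ 6 * inverse E25)"
proof -
  interpret dissection5 "res5 0 E1" "res5 1 E1" "res5 2 E1" E1
  proof
    show "E1 = res5 0 E1 + res5 1 E1 + res5 2 E1"
    proof (rule fps_ext)
      fix n :: nat
      have "n mod 5 = 0 \<or> n mod 5 = 1 \<or> n mod 5 = 2 \<or> n mod 5 = 3 \<or> n mod 5 = 4"
        by presburger
      then show "E1 $ n = (res5 0 E1 + res5 1 E1 + res5 2 E1) $ n"
        by (elim disjE) (simp_all add: res5_def euler_fps_nth_eq_0)
    qed
  qed (rule homog5_res5)+
  let ?A = "res5 0 E1" and ?B = "res5 1 E1" and ?C = "res5 2 E1"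
  \<comment> \<open>By Jacobi's identity the cube has no exponents that are 2 modulo 5; the factor A
    in \<open>res5_2_cube\<close> cancels because its constant term is 1.\<close>
  have "res5 2 (E1 ^ 3) = 0"
    by (auto simp: res5_def fps_eq_iff euler_fps_cube_nth_eq_0)
  moreover have "?A $ 0 = 1"
    by (simp add: res5_def)
  then have "?A \<noteq> 0" by auto
  ultimately have "?A * ?C + ?B ^ 2 = 0"
    using res5_2_cube by simp
  then have AC: "?A * ?C = - (?B ^ 2)"
    by (simp add: add_eq_0_iff2)
  obtain w :: complex where w: "1 + w + w ^ 2 + w ^ 3 + w ^ 4 = 0"
    using ex_primitive_fifth_root by blast
  have lin: "E1 oo (fps_const (w ^ j) * fps_X) =
      ?A + fps_const w ^ j * ?B + fps_const w ^ (j * 2) * ?C" for j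
  proof -
    have "(w ^ j) ^ 5 = 1"
      by (metis fifth_root_traces(3)[OF w] mult.commute power_mult power_one)
    then show ?thesis
      by (subst E_eq)
        (simp add: fps_compose_add_distrib homog5_compose_linear[OF homog(1)]
          homog5_compose_linear[OF homog(2)] homog5_compose_linear[OF homog(3)] fps_const_power power_mult
          del: One_nat_def)
  qed
  have "fps_const (1 + w + w ^ 2 + w ^ 3 + w ^ 4) = 0"
    unfolding w by simp
  then have w': "1 + fps_const w + fps_const w ^ 2 + fps_const w ^ 3 + fps_const w ^ 4 = 0"
    by (simp only: fps_const_power flip: fps_const_add fps_const_1_eq_1)
  \<comment> \<open>The norm is computed from the dissection, to be compared with its value in
    \<open>fps_norm5_euler\<close>.\<close>
  have "fps_norm5 w E1 = (?A + ?B + ?C) * (?A + fps_const w * ?B + fps_const w ^ 2 * ?C) *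
      (?A + fps_const w ^ 2 * ?B + fps_const w ^ 4 * ?C) *
      (?A + fps_const w ^ 3 * ?B + fps_const w ^ 6 * ?C) *
      (?A + fps_const w ^ 4 * ?B + fps_const w ^ 8 * ?C)"
    unfolding fps_norm5_def lin by (simp add: lessThan_nat_numeral lessThan_Suc mult_ac)
  also have "\<dots> = ?A ^ 5 + 11 * ?B ^ 5 + ?C ^ 5"
    by (rule norm_trinomial[OF w' AC])
  finally have "(?A ^ 5 + 11 * ?B ^ 5 + ?C ^ 5) * E25 = E5 ^ 6"
    using fps_norm5_euler[OF w] by simp
  then have "(?A ^ 5 + 11 * ?B ^ 5 + ?C ^ 5) * E25 * inverse E25 = E5 ^ 6 * inverse E25"
    by simp
  then have N: "E5 ^ 6 * inverse E25 = ?A ^ 5 + 11 * ?B ^ 5 + ?C ^ 5"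
    by (simp add: mult.assoc inverse_mult_eq_1')
  show ?thesis
    by unfold_locales (use AC N res5_1_euler in auto)
qed

text \<open>Unlike \<open>res5\<close>, this rescales the exponents: \<open>sect5 0\<close> is the
  operator U_5, and \<open>dil5\<close> below is V_5.\<close>

definition sect5 :: "nat \<Rightarrow> 'a::comm_ring_1 fps \<Rightarrow> 'a fps" where
  "sect5 r f = Abs_fps (\<lambda>n. f $ (5 * n + r))"

abbreviation dil5 :: "'a::comm_ring_1 fps \<Rightarrow> 'a fps" where
  "dil5 f \<equiv> f oo fps_X ^ 5"

lemma sect5_res5: "r < 5 \<Longrightarrow> sect5 r (res5 r f) = sect5 r f"
  by (simp add: sect5_def res5_def)

lemma sect5_X_power_dil5: "sect5 r (fps_X ^ r * dil5 f) = f"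
  by (simp add: sect5_def fps_eq_iff fps_X_power_mult_nth fps_nth_compose_X_power)

lemma sect5_X_power: "m \<le> r \<Longrightarrow> sect5 r (fps_X ^ m * f) = sect5 (r - m) f"
  by (simp add: sect5_def fps_eq_iff fps_X_power_mult_nth)

lemma sect5_add: "sect5 r (f + g) = sect5 r f + sect5 r g"
  by (simp add: sect5_def fps_eq_iff)

lemma homog5_eq_dil5:
  assumes "homog5 r f" "r < 5"
  shows "f = fps_X ^ r * dil5 (sect5 r f)"
proof (rule fps_ext)
  fix n
  show "f $ n = (fps_X ^ r * dil5 (sect5 r f)) $ n"
  proof (cases "n mod 5 = r")
    case True
    then obtain m where "n = 5 * m + r" by (metis mult_div_mod_eq)
    then show ?thesis
      by (simp add: fps_X_power_mult_nth fps_nth_compose_X_power sect5_def)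
  next
    case False
    then have "f $ n = 0"
      using assms by (auto simp: homog5_def)
    moreover have "\<not> (r \<le> n \<and> 5 dvd (n - r))"
    proof
      assume "r \<le> n \<and> 5 dvd (n - r)"
      then obtain k where "n = r + 5 * k" by (metis dvdE le_add_diff_inverse)
      with False assms(2) show False by simp
    qed
    ultimately show ?thesis
      by (auto simp: fps_X_power_mult_nth fps_nth_compose_X_power)
  qed
qed

lemma sect5_mult_dil5:
  fixes f g :: "'a::idom fps"
  assumes "r < 5"
  shows "sect5 r (f * dil5 g) = sect5 r f * g"
proof -
  have "homog5 0 (dil5 g)"
    by (rule homog5_compose_X_power) simp_all
  then have "res5 r (f * dil5 g) = res5 r f * dil5 g"
    by (rule res5_mult) simp
  also have "res5 r f = fps_X ^ r * dil5 (sect5 r (res5 r f))"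
    by (rule homog5_eq_dil5[OF homog5_res5 assms])
  finally have "res5 r (f * dil5 g) = fps_X ^ r * dil5 (sect5 r f * g)"
    by (simp add: sect5_res5[OF assms] fps_compose_mult_distrib mult.assoc)
  then show ?thesis
    by (metis sect5_res5[OF assms] sect5_X_power_dil5)
qed

lemma dil5_simps:
  fixes f g :: "'a::idom fps"
  shows "dil5 (f + g) = dil5 f + dil5 g" "dil5 (f - g) = dil5 f - dil5 g"
    "dil5 (f * g) = dil5 f * dil5 g" "dil5 (f ^ n) = dil5 f ^ n" "dil5 (- f) = - dil5 f"
    "dil5 fps_X = (fps_X ^ 5 :: 'a fps)"
  by (simp_all add: fps_compose_add_distrib fps_compose_sub_distrib fps_compose_mult_distrib
      fps_compose_uminus flip: fps_compose_power)

lemma E25_eq: "E25 = dil5 E5"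
proof -
  have "(fps_X ^ 5 :: complex fps) oo fps_X ^ 5 = fps_X ^ 25"
    by (simp add: fps_X_power_compose flip: power_mult)
  then show ?thesis
    by (simp flip: fps_compose_assoc)
qed

definition inv_E1 :: "complex fps" where "inv_E1 = inverse E1"
definition inv_E5 :: "complex fps" where "inv_E5 = inverse E5"

lemma E1_inv_E1: "E1 * inv_E1 = 1"
  by (simp add: inv_E1_def inverse_mult_eq_1')

lemma E5_inv_E5: "E5 * inv_E5 = 1"
  by (simp add: inv_E5_def inverse_mult_eq_1')

lemma dil5_inv_E1: "dil5 inv_E1 = inv_E5"
  by (simp add: inv_E1_def inv_E5_def fps_inverse_compose)

lemma dil5_inv_E5: "dil5 inv_E5 = inverse E25"
  by (simp add: inv_E5_def E25_eq fps_inverse_compose)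

interpretation euler: euler_dissection "res5 0 E1" "res5 1 E1" "res5 2 E1" E1
  "fps_X * E25" "E5 ^ 6 * inverse E25"
  by (rule euler_dissection_euler)

lemma sect5_euler_power:
  assumes "euler.P k = fps_X ^ r * dil5 f" "r < 5" "k mod 5 = r"
  shows "sect5 r (E1 ^ k) = f"
proof -
  have "res5 r (E1 ^ k) = euler.P k"
    unfolding euler.P_def by (rule res5_cong) (use assms in simp)
  then show ?thesis
    by (metis assms(1,2) sect5_res5 sect5_X_power_dil5)
qed

text \<open>Here u = q \<open>dil5 E5\<close> and N = \<open>dil5 n\<close>, so each entry of
  \<open>P_values\<close> is q^r times a dilation, with u^5 coming from q E5^5.\<close>

lemma sect5_euler_values:
  defines "n \<equiv> E1 ^ 6 * inv_E5"
  shows "sect5 1 (E1 ^ 6) = - 25 * fps_X * E5 ^ 6 - 6 * E5 * n"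
    and "sect5 2 (E1 ^ 12) = - 3125 * fps_X ^ 2 * E5 ^ 12 + 54 * E5 ^ 2 * n ^ 2"
    and "sect5 1 (E1 ^ 16) = - 78125 * fps_X ^ 3 * E5 ^ 16 - 50000 * fps_X ^ 2 * E5 ^ 11 * n
           - 4000 * fps_X * E5 ^ 6 * n ^ 2 - 16 * E5 * n ^ 3"
    and "sect5 3 (E1 ^ 18) = - 390625 * fps_X ^ 3 * E5 ^ 18 - 510 * E5 ^ 3 * n ^ 3"
proof -
  define N where "N = E5 ^ 6 * inverse E25"
  have N: "dil5 n = N"
    unfolding n_def N_def dil5_simps dil5_inv_E5 ..
  show "sect5 1 (E1 ^ 6) = - 25 * fps_X * E5 ^ 6 - 6 * E5 * n"
    by (rule sect5_euler_power, unfold euler.P_values dil5_simps N E25_eq[symmetric] N_def[symmetric]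
        numeral_compose neg_numeral_compose) (algebra, simp_all)
  show "sect5 2 (E1 ^ 12) = - 3125 * fps_X ^ 2 * E5 ^ 12 + 54 * E5 ^ 2 * n ^ 2"
    by (rule sect5_euler_power, unfold euler.P_values dil5_simps N E25_eq[symmetric] N_def[symmetric]
        numeral_compose neg_numeral_compose) (algebra, simp_all)
  show "sect5 1 (E1 ^ 16) = - 78125 * fps_X ^ 3 * E5 ^ 16 - 50000 * fps_X ^ 2 * E5 ^ 11 * n
           - 4000 * fps_X * E5 ^ 6 * n ^ 2 - 16 * E5 * n ^ 3"
    by (rule sect5_euler_power, unfold euler.P_values dil5_simps N E25_eq[symmetric] N_def[symmetric]
        numeral_compose neg_numeral_compose) (algebra, simp_all)
  show "sect5 3 (E1 ^ 18) = - 390625 * fps_X ^ 3 * E5 ^ 18 - 510 * E5 ^ 3 * n ^ 3"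
    by (rule sect5_euler_power, unfold euler.P_values dil5_simps N E25_eq[symmetric] N_def[symmetric]
        numeral_compose neg_numeral_compose) (algebra, simp_all)
qed

text \<open>The coefficient of \<open>q\<^sup>n\<close> in \<open>E1 ^ 16\<close> belongs to \<open>q\<close> to the power \<open>3n + 2\<close> in \<open>\<eta>(3\<tau>)\<^sup>1\<^sup>6\<close>,
  and that of \<open>q\<^sup>n\<close> in \<open>hecke_euler16\<close> to the power \<open>3n + 1\<close> in its image under \<open>T\<^sub>5\<close>. This
  accounts for the section \<open>5n + 1\<close>, for the factor \<open>fps_X ^ 3\<close>, and below for the section
  \<open>5n + 3\<close> and the factor \<open>fps_X\<close>. The constant \<open>78125\<close> is \<open>5\<^sup>7\<close>.\<close>

definition hecke_euler16 :: "complex fps" where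
  "hecke_euler16 = sect5 1 (E1 ^ 16) + 78125 * (fps_X ^ 3 * dil5 (E1 ^ 16))"

text \<open>The term 5^7 V_5 cancels the summand - 78125 q^3 E5^16 of the section. The bracket is
  E_4 E(q)^8 written in eta quotients of level 5.\<close>

lemma hecke_euler16_eq:
  "hecke_euler16 = - 16 * (E1 ^ 18 * inv_E5 ^ 2 + 250 * fps_X * E1 ^ 12 * E5 ^ 4
    + 3125 * fps_X ^ 2 * E1 ^ 6 * E5 ^ 10)"
proof -
  have 1: "E5 * (E1 ^ 6 * inv_E5) ^ 3 = E1 ^ 18 * inv_E5 ^ 2 * (E5 * inv_E5)"
    "E5 ^ 6 * (E1 ^ 6 * inv_E5) ^ 2 = E1 ^ 12 * E5 ^ 4 * (E5 * inv_E5) ^ 2"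
    "E5 ^ 11 * (E1 ^ 6 * inv_E5) = E1 ^ 6 * E5 ^ 10 * (E5 * inv_E5)"
    by algebra+
  show ?thesis
    unfolding hecke_euler16_def sect5_euler_values dil5_simps
    using 1[unfolded E5_inv_E5 power_one mult_1_right] by algebra
qed

text \<open>Dilation gives an expression in E(q^5) and E(q^25); \<open>eisenstein_identity\<close>
  turns it into one in E(q) and E(q^5), comparable with the second Hecke step.\<close>

lemma dil5_hecke_euler16:
  "fps_X * dil5 hecke_euler16 = - 16 * (fps_X * E5 ^ 6 * E1 ^ 10 + 10 * fps_X ^ 2 * E5 ^ 12 * E1 ^ 4
    + 5 * fps_X ^ 3 * E5 ^ 18 * inv_E1 ^ 2)"
proof -
  define N where "N = E5 ^ 6 * inverse E25"
  define u where "u = fps_X * E25"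
  have I: "E25 * inverse E25 = 1"
    by (simp add: inverse_mult_eq_1')
  have uN: "u * N = fps_X * E5 ^ 6"
    unfolding u_def N_def using I by algebra
  have "dil5 hecke_euler16 = - 16 * (E5 ^ 18 * inverse E25 ^ 2 + 250 * fps_X ^ 5 * E5 ^ 12 * E25 ^ 4
      + 3125 * (fps_X ^ 5) ^ 2 * E5 ^ 6 * E25 ^ 10)"
    unfolding hecke_euler16_eq dil5_simps dil5_inv_E5 numeral_compose neg_numeral_compose E25_eq[symmetric] ..
  moreover have "E5 ^ 18 * inverse E25 ^ 2 = E5 ^ 6 * N ^ 2"
    unfolding N_def by (simp add: power_mult_distrib flip: power_mult power_add mult.assoc)
  moreover have "fps_X ^ 5 * E25 ^ 4 * E5 ^ 12 = E5 ^ 6 * (u ^ 5 * N)"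
    unfolding N_def u_def using I by algebra
  moreover have "(fps_X ^ 5) ^ 2 * E25 ^ 10 = u ^ 10"
    by (simp add: u_def power_mult_distrib flip: power_mult)
  ultimately have "fps_X * dil5 hecke_euler16 =
      - 16 * (fps_X * E5 ^ 6) * (N ^ 2 + 250 * u ^ 5 * N + 3125 * u ^ 10)"
    by algebra
  also have "N ^ 2 + 250 * u ^ 5 * N + 3125 * u ^ 10 =
      E1 ^ 10 + 10 * (u * N) * E1 ^ 4 + 5 * (u * N) ^ 2 * inv_E1 ^ 2"
    using euler.eisenstein_identity[folded N_def u_def] E1_inv_E1 by algebra
  also have "- 16 * (fps_X * E5 ^ 6) * \<dots> = - 16 * (fps_X * E5 ^ 6 * E1 ^ 10
      + 10 * fps_X ^ 2 * E5 ^ 12 * E1 ^ 4 + 5 * fps_X ^ 3 * E5 ^ 18 * inv_E1 ^ 2)"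
    unfolding uN by algebra
  finally show ?thesis .
qed

text \<open>With the last term moved to the left, this is T_5^2 f = 92160 f.\<close>

lemma sect5_3_hecke_euler16:
  "sect5 3 hecke_euler16 = 92160 * E1 ^ 16 - 78125 * (fps_X * dil5 hecke_euler16)"
proof -
  \<comment> \<open>\<open>E5\<close> and \<open>inv_E5\<close> are dilations, so only E^18, q E^12
    and q^2 E^6 remain to be sectioned, with offsets 3, 2 and 1.\<close>
  have "hecke_euler16 = E1 ^ 18 * dil5 (- 16 * inv_E1 ^ 2) + fps_X ^ 1 * (E1 ^ 12 * dil5 (- 4000 * E1 ^ 4))
      + fps_X ^ 2 * (E1 ^ 6 * dil5 (- 50000 * E1 ^ 10))"
    unfolding hecke_euler16_eq dil5_simps dil5_inv_E1 neg_numeral_compose numeral_compose by algebra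
  then have "sect5 3 hecke_euler16 = sect5 3 (E1 ^ 18) * (- 16 * inv_E1 ^ 2) + sect5 2 (E1 ^ 12) * (- 4000 * E1 ^ 4)
      + sect5 1 (E1 ^ 6) * (- 50000 * E1 ^ 10)"
  proof -
    have "sect5 3 (fps_X ^ 1 * f) = sect5 2 f" "sect5 3 (fps_X ^ 2 * f) = sect5 1 f" for f :: "complex fps"
      using sect5_X_power[of 1 3 f] sect5_X_power[of 2 3 f] by simp_all
    moreover have "sect5 1 (f * dil5 g) = sect5 1 f * g" "sect5 2 (f * dil5 g) = sect5 2 f * g"
      "sect5 3 (f * dil5 g) = sect5 3 f * g" for f g :: "complex fps"
      by (rule sect5_mult_dil5, simp)+
    ultimately show ?thesis
      unfolding \<open>hecke_euler16 = _\<close> by (simp only: sect5_add)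
  qed
  \<comment> \<open>The last terms of the three sections are multiples of E^16 with total 16 * 510 -
    4000 * 54 + 50000 * 6 = 92160; the first terms make up the dilation.\<close>
  moreover have "E5 ^ 3 * (E1 ^ 6 * inv_E5) ^ 3 * inv_E1 ^ 2 = E1 ^ 16"
    using E1_inv_E1 E5_inv_E5 by algebra
  moreover have "E5 ^ 2 * (E1 ^ 6 * inv_E5) ^ 2 * E1 ^ 4 = E1 ^ 16"
    using E5_inv_E5 by algebra
  moreover have "E5 * (E1 ^ 6 * inv_E5) * E1 ^ 10 = E1 ^ 16"
    using E5_inv_E5 by algebra
  ultimately show ?thesis
    unfolding sect5_euler_values dil5_hecke_euler16 by algebra
qed

subsection \<open>Regular partitions\<close>

lemma finite_multiset_sum_eq: "finite {M. sum_mset M = n \<and> (0 :: nat) \<notin># M}"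
proof (induction n rule: less_induct)
  case (less n)
  have "{M. sum_mset M = n \<and> 0 \<notin># M} \<subseteq>
      insert {#} (\<Union>x\<in>{1..n}. add_mset x ` {M. sum_mset M = n - x \<and> 0 \<notin># M})"
  proof safe
    fix M :: "nat multiset"
    assume M: "n = sum_mset M" "0 \<notin># M"
      "M \<notin> (\<Union>x\<in>{1..sum_mset M}. add_mset x ` {M'. sum_mset M' = sum_mset M - x \<and> 0 \<notin># M'})"
    show "M = {#}"
    proof (cases M)
      case (add x M')
      with M(2) have "x \<in> {1..sum_mset M}" "sum_mset M' = sum_mset M - x" "0 \<notin># M'" by auto
      with M(3) add show ?thesis by blast
    qed
  qed
  moreover have "finite (\<Union>x\<in>{1..n}. add_mset x ` {M. sum_mset M = n - x \<and> 0 \<notin># M})"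
    by (intro finite_UN_I finite_imageI less) auto
  ultimately show ?case
    by (rule finite_subset[OF _ finite.insertI])
qed

definition partitions_in :: "nat set \<Rightarrow> nat \<Rightarrow> nat multiset set" where
  "partitions_in S n = {M. sum_mset M = n \<and> set_mset M \<subseteq> S}"

lemma finite_partitions_in: "0 \<notin> S \<Longrightarrow> finite (partitions_in S n)"
  by (rule finite_subset[OF _ finite_multiset_sum_eq[of n]]) (auto simp: partitions_in_def)

lemma card_partitions_in_insert:
  assumes "x \<notin> S" "0 \<notin> insert x S"
  shows "card (partitions_in (insert x S) n) =
    card (partitions_in S n) + (if x \<le> n then card (partitions_in (insert x S) (n - x)) else 0)"
proof -
  define T where "T = (if x \<le> n then add_mset x ` partitions_in (insert x S) (n - x) else {})"
  have "M \<in> T" if M: "M \<in> partitions_in (insert x S) n" "M \<notin> partitions_in S n" for M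
  proof -
    from M have "x \<in># M" by (auto simp: partitions_in_def)
    then obtain M' where M': "M = add_mset x M'" by (metis mset_add)
    with M have "x \<le> n" "M' \<in> partitions_in (insert x S) (n - x)"
      by (auto simp: partitions_in_def)
    with M' show ?thesis by (simp add: T_def)
  qed
  moreover have "partitions_in S n \<subseteq> partitions_in (insert x S) n"
    by (auto simp: partitions_in_def)
  moreover have "T \<subseteq> partitions_in (insert x S) n"
    by (auto simp: T_def partitions_in_def split: if_splits)
  ultimately have "partitions_in (insert x S) n = partitions_in S n \<union> T"
    by blast
  moreover have "card (partitions_in S n \<union> T) = card (partitions_in S n) + card T"
  proof (rule card_Un_disjoint)
    show "finite (partitions_in S n)" "finite T"
      using assms finite_partitions_in by (auto simp: T_def)
    have "x \<in># M" if "M \<in> T" for M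
      using that by (auto simp: T_def split: if_splits)
    moreover have "x \<notin># M" if "M \<in> partitions_in S n" for M
      using that assms(1) unfolding partitions_in_def by blast
    ultimately show "partitions_in S n \<inter> T = {}"
      by blast
  qed
  moreover have "card T = (if x \<le> n then card (partitions_in (insert x S) (n - x)) else 0)"
    by (simp add: T_def card_image inj_on_def)
  ultimately show ?thesis by simp
qed

lemma partitions_in_generating_function:
  assumes "finite S" "0 \<notin> S"
  shows "Abs_fps (\<lambda>n. of_nat (card (partitions_in S n))) * (\<Prod>i\<in>S. 1 - fps_X ^ i) =
    (1 :: 'a::comm_ring_1 fps)"
  using assms
proof (induction S)
  case empty
  have "partitions_in {} n = (if n = 0 then {{#}} else {})" for n
    by (auto simp: partitions_in_def)
  then show ?case by (simp add: fps_eq_iff)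
next
  case (insert x S)
  let ?F = "\<lambda>S. Abs_fps (\<lambda>n. of_nat (card (partitions_in S n))) :: 'a fps"
  have "?F (insert x S) * (1 - fps_X ^ x) = ?F S"
    using insert by (auto simp: fps_eq_iff algebra_simps fps_X_power_mult_nth
        fps_X_power_mult_right_nth card_partitions_in_insert)
  with insert show ?case by (simp flip: mult.assoc)
qed

lemma b_eq_card_partitions_in:
  assumes "n \<le> N"
  shows "b l n = card (partitions_in {i \<in> {1..N}. \<not> l dvd i} n)"
proof -
  have "(\<forall>x\<in>#M. 0 < x \<and> \<not> l dvd x) \<longleftrightarrow> set_mset M \<subseteq> {i \<in> {1..N}. \<not> l dvd i}"
    if M: "sum_mset M = n" for M
  proof -
    have "x \<le> N" if "x \<in># M" for x
    proof -
      obtain M' where "M = add_mset x M'" using \<open>x \<in># M\<close> by (metis mset_add)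
      with M assms show ?thesis by simp
    qed
    then show ?thesis by (fastforce simp: Suc_le_eq)
  qed
  then have "l_regular_partitions l n = partitions_in {i \<in> {1..N}. \<not> l dvd i} n"
    unfolding l_regular_partitions_def partitions_in_def by blast
  then show ?thesis by (simp add: b_def)
qed

text \<open>Parts are bounded by l K so that the multiples of l among them are exactly l i with i <=
  K, whose factors form \<open>qpoch K\<close> at q^l.\<close>

lemma b_generating_function:
  assumes "l > 0"
  shows "Abs_fps (\<lambda>n. of_nat (b l n)) * euler_fps = (euler_fps oo fps_X ^ l :: 'a::idom fps)"
proof (rule fps_agree_eqI)
  fix K
  let ?S = "{i \<in> {1..l * K}. \<not> l dvd i}"
  let ?F = "Abs_fps (\<lambda>n. of_nat (card (partitions_in ?S n))) :: 'a fps"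
  have K: "K \<le> l * K" using assms by simp
  have "fps_agree K (Abs_fps (\<lambda>n. of_nat (b l n))) ?F"
    unfolding fps_agree_def fps_nth_Abs_fps
  proof (intro allI impI)
    fix n assume "n < K"
    with K have "n \<le> l * K" by linarith
    then show "of_nat (b l n) = (of_nat (card (partitions_in ?S n)) :: 'a)"
      by (simp only: b_eq_card_partitions_in)
  qed
  then have "fps_agree K (Abs_fps (\<lambda>n. of_nat (b l n)) * euler_fps) (?F * qpoch (l * K))"
    using K by (intro fps_agree_mult fps_agree_sym[OF fps_agree_qpoch]) (auto intro: le_SucI)
  also have "qpoch (l * K) = (\<Prod>i\<in>?S. 1 - fps_X ^ i) * (\<Prod>i\<in>{i \<in> {1..l * K}. l dvd i}. 1 - fps_X ^ i :: 'a fps)"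
    unfolding qpoch_def
    by (subst prod.union_disjoint[symmetric]) (auto intro!: prod.cong)
  also have "(\<Prod>i\<in>{i \<in> {1..l * K}. l dvd i}. 1 - fps_X ^ i :: 'a fps) = (\<Prod>i=1..K. 1 - fps_X ^ (l * i))"
    using assms by (intro prod.reindex_bij_witness[of _ "\<lambda>i. l * i" "\<lambda>i. i div l"]) auto
  also have "\<dots> = qpoch K oo fps_X ^ l"
    using assms by (simp add: qpoch_def fps_compose_prod_distrib fps_compose_sub_distrib fps_X_power_compose
        power_mult)
  also have "?F * ((\<Prod>i\<in>?S. 1 - fps_X ^ i) * (qpoch K oo fps_X ^ l)) = qpoch K oo fps_X ^ l"
    using partitions_in_generating_function[of ?S, where 'a = 'a] by (simp flip: mult.assoc)
  also have "fps_agree K \<dots> (euler_fps oo fps_X ^ l)"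
  proof -
    have "fps_agree K (qpoch K) (euler_fps :: 'a fps)"
      by (rule fps_agree_qpoch) simp
    then show ?thesis
      using assms by (auto simp: fps_agree_def fps_nth_compose_X_power intro: le_less_trans[OF div_le_dividend])
  qed
  finally show "fps_agree K (Abs_fps (\<lambda>n. of_nat (b l n)) * euler_fps) (euler_fps oo fps_X ^ l :: 'a fps)" .
qed

section \<open>Reduction modulo an odd prime\<close>

lemma prime_dvd_one_minus_power:
  fixes y :: "'a::comm_ring_1"
  assumes "prime p" "odd p"
  shows "of_nat p dvd (1 - y) ^ p - (1 - y ^ p)"
proof -
  have p: "p > 0" using assms(1) by (rule prime_gt_0_nat)
  have "(1 - y) ^ p = (\<Sum>k\<le>p. of_nat (p choose k) * (- y) ^ k)"
    using binomial_ring[of "- y" 1 p] by (simp add: algebra_simps)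
  also have "{..p} = insert 0 (insert p {1..<p})" using p by auto
  also have "(\<Sum>k\<in>\<dots>. of_nat (p choose k) * (- y) ^ k) =
      1 - y ^ p + (\<Sum>k\<in>{1..<p}. of_nat (p choose k) * (- y) ^ k)"
    using p assms(2) by (simp add: power_minus_odd)
  finally have "(1 - y) ^ p - (1 - y ^ p) = (\<Sum>k\<in>{1..<p}. of_nat (p choose k) * (- y) ^ k)"
    by simp
  \<comment> \<open>The inner binomial coefficients are divisible by p; the outer terms gave 1 - y^p
    because p is odd.\<close>
  moreover have "of_nat p dvd (of_nat (p choose k) * (- y) ^ k)" if "k \<in> {1..<p}" for k
  proof -
    have "p dvd (p choose k)"
      using that p assms(1) by (intro dvd_choose_prime) auto
    then obtain m where "p choose k = p * m" ..
    then show ?thesis by (simp add: mult.assoc)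
  qed
  ultimately show ?thesis
    by (auto intro: dvd_sum)
qed

lemma dvd_diff_prod:
  fixes f g :: "'b \<Rightarrow> 'a::comm_ring_1"
  assumes "\<And>i. i \<in> S \<Longrightarrow> d dvd f i - g i"
  shows "d dvd prod f S - prod g S"
  using assms
proof (induction S rule: infinite_finite_induct)
  case (insert x S)
  have "prod f (insert x S) - prod g (insert x S) = (f x - g x) * prod f S + g x * (prod f S - prod g S)"
    using insert by (simp add: algebra_simps)
  with insert show ?case by (simp add: dvd_add)
qed auto

lemma of_int_dvd_fps_nth: "of_int d dvd f \<Longrightarrow> (d :: int) dvd f $ n"
  by (auto simp: fps_of_int[symmetric] elim!: dvdE)

lemma prime_dvd_euler_power:
  assumes "prime p" "odd p"
  shows "int p dvd (euler_fps ^ p - (euler_fps oo fps_X ^ p)) $ n"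
proof -
  have p: "p > 0" using assms(1) by (rule prime_gt_0_nat)
  let ?q = "qpoch n :: int fps"
  have a: "fps_agree (Suc n) ?q euler_fps"
    by (rule fps_agree_qpoch) simp
  have "?q oo fps_X ^ p = (\<Prod>i=1..n. 1 - (fps_X ^ i) ^ p)"
    using p by (simp add: qpoch_def fps_compose_prod_distrib fps_compose_sub_distrib fps_X_power_compose
        mult.commute flip: power_mult)
  moreover have "of_nat p dvd (\<Prod>i=1..n. (1 - fps_X ^ i) ^ p) - (\<Prod>i=1..n. 1 - (fps_X ^ i) ^ p :: int fps)"
    by (intro dvd_diff_prod prime_dvd_one_minus_power assms)
  ultimately have "of_nat p dvd ?q ^ p - (?q oo fps_X ^ p)"
    by (simp add: qpoch_def prod_power_distrib)
  then have "int p dvd (?q ^ p - (?q oo fps_X ^ p)) $ n"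
    by (intro of_int_dvd_fps_nth) simp
  moreover have "(?q ^ p) $ n = (euler_fps ^ p) $ n"
    using fps_agree_power[OF a, of p] by (simp add: fps_agree_def)
  moreover have "(?q oo fps_X ^ p) $ n = (euler_fps oo fps_X ^ p) $ n"
    using a p by (auto simp: fps_nth_compose_X_power fps_agree_def intro: le_imp_less_Suc[OF div_le_dividend])
  ultimately show ?thesis
    by simp
qed

text \<open>E B = E(q^p) is congruent to E^p modulo p, and E cancels: with constant term 1 it is
  invertible over the integers.\<close>

lemma b_cong_euler_power:
  assumes "prime p" "odd p"
  shows "[int (b p n) = (euler_fps ^ (p - 1)) $ n] (mod int p)"
proof -
  have p: "p > 0" using assms(1) by (rule prime_gt_0_nat)
  let ?E = "euler_fps :: int fps" and ?B = "Abs_fps (\<lambda>n. of_nat (b p n)) :: int fps"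
  define J where "J = fps_right_inverse ?E 1"
  have J: "?E * J = 1"
    unfolding J_def by (rule fps_right_inverse) simp
  define H where "H = ?E ^ p - (?E oo fps_X ^ p)"
  have "?E ^ p = ?E * ?E ^ (p - 1)"
    using p by (simp add: power_eq_if)
  then have "H = ?E * (?E ^ (p - 1) - ?B)"
    using b_generating_function[OF p, where 'a = int] by (simp add: H_def algebra_simps)
  then have "?E ^ (p - 1) - ?B = H * J"
    using J by (simp add: mult_ac)
  then have "(?E ^ (p - 1)) $ n - int (b p n) = (\<Sum>i=0..n. H $ i * J $ (n - i))"
    by (metis fps_mult_nth fps_nth_Abs_fps fps_sub_nth)
  moreover have "int p dvd (\<Sum>i=0..n. H $ i * J $ (n - i))"
    unfolding H_def by (intro dvd_sum dvd_mult2 prime_dvd_euler_power[OF assms])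
  ultimately show ?thesis
    by (subst cong_sym_eq) (simp add: cong_iff_dvd_diff)
qed

subsection \<open>Coefficients\<close>

text \<open>The Hecke identities are proved over the complex numbers, which contain the fifth roots
  of unity; this embedding carries them back to integer coefficients.\<close>

definition map_of_int :: "int fps \<Rightarrow> complex fps" where
  "map_of_int f = Abs_fps (\<lambda>n. of_int (f $ n))"

lemma map_of_int_mult: "map_of_int (f * g) = map_of_int f * map_of_int g"
  by (simp add: map_of_int_def fps_eq_iff fps_mult_nth)

lemma map_of_int_power: "map_of_int (f ^ m) = map_of_int f ^ m"
  by (induction m) (simp_all add: map_of_int_mult, simp add: map_of_int_def fps_eq_iff)

lemma map_of_int_qpoch: "map_of_int (qpoch n) = qpoch n"
proof -
  have "map_of_int (1 - fps_X ^ k) = 1 - fps_X ^ k" for k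
    by (simp add: map_of_int_def fps_eq_iff)
  then show ?thesis
    by (induction n) (simp_all add: qpoch_Suc map_of_int_mult map_of_int_power
        del: power_Suc, simp add: map_of_int_def fps_eq_iff)
qed

lemma map_of_int_euler: "map_of_int euler_fps = euler_fps"
proof (rule fps_ext)
  fix n
  show "map_of_int euler_fps $ n = euler_fps $ n"
    using arg_cong[OF map_of_int_qpoch[of n], of "\<lambda>f. f $ n"]
    by (simp add: map_of_int_def euler_fps_def)
qed

definition euler16_coeff :: "nat \<Rightarrow> int" where "euler16_coeff n = (euler_fps ^ 16) $ n"

lemma of_int_euler16_coeff: "of_int (euler16_coeff n) = (E1 ^ 16) $ n"
  using arg_cong[OF map_of_int_power[of euler_fps 16], of "\<lambda>f. f $ n"]
  by (simp add: euler16_coeff_def map_of_int_euler) (simp add: map_of_int_def)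

definition hecke_coeff :: "nat \<Rightarrow> int" where
  "hecke_coeff n = euler16_coeff (5 * n + 1)
    + 78125 * (if 3 \<le> n \<and> 5 dvd (n - 3) then euler16_coeff ((n - 3) div 5) else 0)"

lemma of_int_hecke_coeff: "of_int (hecke_coeff n) = hecke_euler16 $ n"
proof -
  have "hecke_euler16 $ n = (E1 ^ 16) $ (5 * n + 1) + 78125 * (fps_X ^ 3 * dil5 (E1 ^ 16)) $ n"
    by (simp add: hecke_euler16_def sect5_def numeral_fps_const)
  also have "(fps_X ^ 3 * dil5 (E1 ^ 16)) $ n =
      (if 3 \<le> n \<and> 5 dvd (n - 3) then (E1 ^ 16) $ ((n - 3) div 5) else 0)"
    by (auto simp: fps_X_power_mult_nth fps_nth_compose_X_power)
  finally show ?thesis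
    by (simp add: hecke_coeff_def flip: of_int_euler16_coeff)
qed

lemma hecke_coeff_5_3:
  "hecke_coeff (5 * n + 3) =
    92160 * euler16_coeff n - 78125 * (if n mod 5 = 1 then hecke_coeff (n div 5) else 0)"
proof -
  have eq: "(fps_X * dil5 hecke_euler16) $ n = (if n mod 5 = 1 then hecke_euler16 $ (n div 5) else 0)"
  proof (cases "n mod 5 = 1")
    case True
    then obtain m where "n = 5 * m + 1" by (metis mult_div_mod_eq)
    moreover from this have "n div 5 = m" by simp
    ultimately show ?thesis
      by (simp add: fps_nth_compose_X_power)
  next
    case False
    then have "n = 0 \<or> \<not> 5 dvd (n - 1)" by presburger
    with False show ?thesis
      by (auto simp: fps_X_mult_nth fps_nth_compose_X_power)
  qed
  have "of_int (hecke_coeff (5 * n + 3)) = sect5 3 hecke_euler16 $ n"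
    by (simp only: of_int_hecke_coeff) (simp add: sect5_def)
  also have "\<dots> = of_int (92160 * euler16_coeff n - 78125 * (if n mod 5 = 1 then hecke_coeff (n div 5) else 0))"
    unfolding sect5_3_hecke_euler16 fps_sub_nth numeral_fps_const fps_mult_left_const_nth eq
    by (simp add: of_int_euler16_coeff of_int_hecke_coeff)
  finally show ?thesis
    by (simp only: of_int_eq_iff)
qed

lemma hecke_coeff_5_3':
  "hecke_coeff (5 * n + 3) = euler16_coeff (25 * n + 16) + 78125 * euler16_coeff n"
  by (simp add: hecke_coeff_def algebra_simps)

section \<open>Congruences modulo 17 and their iteration\<close>

lemma euler16_coeff_625: "[euler16_coeff (625 * n + 416) = 2 * euler16_coeff n] (mod 17)"
proof -
  \<comment> \<open>With m = 25n + 16, both sides are \<open>hecke_coeff (5 * m + 3)\<close>: by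
    definition on the left, by the eigenvalue relation on the right.\<close>
  have "euler16_coeff (625 * n + 416) + 78125 * euler16_coeff (25 * n + 16) =
      92160 * euler16_coeff (25 * n + 16) - 78125 * hecke_coeff (5 * n + 3)"
  proof -
    have "(25 * n + 16) mod 5 = 1" "(25 * n + 16) div 5 = 5 * n + 3" by presburger+
    then show ?thesis
      using hecke_coeff_5_3[of "25 * n + 16"] hecke_coeff_5_3'[of "25 * n + 16"] by (simp add: algebra_simps)
  qed
  \<comment> \<open>The constants are 92160 - 2 * 78125 = - 17 * 3770 and - 78125^2 = 2 - 17 *
    359030331.\<close>
  then have "euler16_coeff (625 * n + 416) - 2 * euler16_coeff n =
      17 * (- 3770 * euler16_coeff (25 * n + 16) - 359030331 * euler16_coeff n)"
    using hecke_coeff_5_3'[of n] by simp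
  then show ?thesis
    unfolding cong_iff_dvd_diff by (metis dvd_triv_left)
qed

text \<open>For these n the V_5 term of \<open>hecke_coeff n\<close> is absent, so the eigenvalue
  relation at 5n + 1 involves only a multiple of \<open>euler16_coeff (5 * n + 1)\<close>, by 92160
  - 2 * 78125.\<close>

lemma euler16_coeff_125: "n mod 5 \<noteq> 3 \<Longrightarrow> [euler16_coeff (125 * n + 41) = 0] (mod 17)"
proof -
  assume "n mod 5 \<noteq> 3"
  then have "\<not> (3 \<le> n \<and> 5 dvd (n - 3))" by presburger
  then have "hecke_coeff n = euler16_coeff (5 * n + 1)" by (auto simp: hecke_coeff_def)
  moreover have "(5 * n + 1) mod 5 = 1" "(5 * n + 1) div 5 = n" by presburger+
  ultimately have "euler16_coeff (125 * n + 41) = 17 * (- 3770 * euler16_coeff (5 * n + 1))"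
    using hecke_coeff_5_3[of "5 * n + 1"] hecke_coeff_5_3'[of "5 * n + 1"] by (simp add: algebra_simps)
  then show ?thesis
    by (simp add: cong_iff_dvd_diff)
qed

lemma b17_cong_euler16_coeff: "[int (b 17 n) = euler16_coeff n] (mod 17)"
proof -
  have "prime (17 :: nat)" by simp
  from b_cong_euler_power[OF this, of n] show ?thesis
    by (simp add: euler16_coeff_def)
qed

lemma five_power_mod_3: "5 ^ (4 * k) mod 3 = (1 :: nat)"
  using power_mod[of "5 ^ 4 :: nat" 3 k] by (simp add: power_mult)

text \<open>This iterates m -> 625 m + 416, whose fixed point is -2/3; hence the shift 2(q - 1)/3,
  written 2t to keep division out of the induction.\<close>

lemma euler16_coeff_iterate:
  assumes "q = 5 ^ (4 * k)" "q = 3 * t + 1"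
  shows "[euler16_coeff (q * n + 2 * t) = 2 ^ k * euler16_coeff n] (mod 17)"
  using assms
proof (induction k arbitrary: q t)
  case (Suc k)
  obtain t' where t': "5 ^ (4 * k) = 3 * t' + (1 :: nat)"
    by (metis five_power_mod_3 mult_div_mod_eq)
  have q: "q = 625 * (3 * t' + 1)"
    unfolding Suc.prems(1) t'[symmetric] by (simp add: power_add)
  with Suc.prems(2) have "t = 625 * t' + 208" by simp
  then have "q * n + 2 * t = 625 * ((3 * t' + 1) * n + 2 * t') + 416"
    using q by (simp add: algebra_simps)
  then have "[euler16_coeff (q * n + 2 * t) = 2 * euler16_coeff ((3 * t' + 1) * n + 2 * t')] (mod 17)"
    using euler16_coeff_625[of "(3 * t' + 1) * n + 2 * t'"] by (simp only:)
  also have "[2 * euler16_coeff ((3 * t' + 1) * n + 2 * t') = 2 * (2 ^ k * euler16_coeff n)] (mod 17)"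
    by (intro cong_mult cong_refl Suc.IH) (simp_all add: t')
  finally show ?case by (simp add: mult.assoc)
qed simp

theorem theorem1p2:
  shows "(\<forall>n k :: nat.
            [b 17 (5^(4*k) * n + (2 * (5^(4*k) - 1)) div 3) = 2^k * b 17 n] (mod 17))
       \<and> (\<forall>r \<in> {0,1,2,4::nat}. \<forall>n k :: nat.
            [b 17 (5^(4*k+4) * n + (5^(4*k+3) * (3*r+1) - 2) div 3) = 0] (mod 17))"
proof (intro conjI allI ballI)
  fix n k :: nat
  obtain t where t: "5 ^ (4 * k) = 3 * t + (1 :: nat)"
    by (metis five_power_mod_3 mult_div_mod_eq)
  have "[int (b 17 (5 ^ (4 * k) * n + 2 * t)) = euler16_coeff (5 ^ (4 * k) * n + 2 * t)] (mod 17)"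
    by (rule b17_cong_euler16_coeff)
  also have "[euler16_coeff (5 ^ (4 * k) * n + 2 * t) = 2 ^ k * euler16_coeff n] (mod 17)"
    by (rule euler16_coeff_iterate[OF refl t])
  also have "[2 ^ k * euler16_coeff n = 2 ^ k * int (b 17 n)] (mod 17)"
    by (intro cong_mult cong_refl cong_sym[OF b17_cong_euler16_coeff])
  finally have "[int (b 17 (5 ^ (4 * k) * n + 2 * t)) = int (2 ^ k * b 17 n)] (mod int 17)"
    by simp
  moreover have "2 * (5 ^ (4 * k) - 1) div 3 = 2 * t"
    unfolding t by simp
  ultimately show "[b 17 (5 ^ (4 * k) * n + 2 * (5 ^ (4 * k) - 1) div 3) = 2 ^ k * b 17 n] (mod 17)"
    by (simp only: cong_int_iff)
next
  fix r n k :: nat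
  assume r: "r \<in> {0, 1, 2, 4}"
  obtain t where t: "5 ^ (4 * k) = 3 * t + (1 :: nat)"
    by (metis five_power_mod_3 mult_div_mod_eq)
  \<comment> \<open>\<open>?m\<close> is covered by \<open>euler16_coeff_125\<close> because r = 3
    is excluded, and the index in the theorem is its k-fold image under m -> 625 m + 416.\<close>
  let ?m = "125 * (5 * n + r) + 41"
  have idx: "5 ^ (4 * k + 4) * n + (5 ^ (4 * k + 3) * (3 * r + 1) - 2) div 3 = 5 ^ (4 * k) * ?m + 2 * t"
  proof -
    have "5 ^ (4 * k + 3) * (3 * r + 1) - 2 = 3 * (125 * (3 * t + 1) * r + 125 * t + 41)"
      unfolding power_add t by (simp add: algebra_simps)
    then show ?thesis
      unfolding power_add t by (simp add: algebra_simps)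
  qed
  have "[int (b 17 (5 ^ (4 * k) * ?m + 2 * t)) = euler16_coeff (5 ^ (4 * k) * ?m + 2 * t)] (mod 17)"
    by (rule b17_cong_euler16_coeff)
  also have "[euler16_coeff (5 ^ (4 * k) * ?m + 2 * t) = 2 ^ k * euler16_coeff ?m] (mod 17)"
    by (rule euler16_coeff_iterate[OF refl t])
  also have "[2 ^ k * euler16_coeff ?m = 2 ^ k * 0] (mod 17)"
    using r by (intro cong_mult cong_refl euler16_coeff_125) auto
  finally have "[int (b 17 (5 ^ (4 * k) * ?m + 2 * t)) = int 0] (mod int 17)"
    by simp
  then show "[b 17 (5 ^ (4 * k + 4) * n + (5 ^ (4 * k + 3) * (3 * r + 1) - 2) div 3) = 0] (mod 17)"
    unfolding idx by (simp only: cong_int_iff)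
qed

end
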